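(* Let $\kappa,\tau,a\in\mathbb{R}$ with $\kappa-4\tau^2\ne0$, let $\epsilon:=\operatorname{sgn}(\kappa-4\tau^2)$, and let $H>0$ with $4H^2+\kappa>0$. The family $\mathcal{F}_{a,H}$ of $G_a$-invariant surfaces of constant mean curvature $H$ in $\mathbb{E}(\kappa,\tau)$ contains a tube if one of the following holds: (1) $\kappa\le0$, $a\tau\epsilon\in\left(-\infty,\frac{\epsilon}{2}\right)$ and $H^2>\dfrac{2\tau^2-a\tau\kappa}{4a\tau-2}$; or (2) $\kappa>0$, $a\tau\epsilon\in\left[\frac{2\tau^2\epsilon}{\kappa},\frac{\epsilon}{2}\right)$ and $H^2>\dfrac{2\tau^2-a\tau\kappa}{4a\tau-2}$; or (3) $\kappa>0$, $a\tau\epsilon\in\left(\frac{4\tau^2\epsilon}{\kappa}-\frac{\epsilon}{2},\frac{2\tau^2\epsilon}{\kappa}\right]$ and $H^2>\dfrac{2\tau^2-a\tau\kappa}{4a\tau+2-\frac{16\tau^2}{\kappa}}$. If $\kappa\le0$ and $a\tau\epsilon\notin\left(-\infty,\frac{\epsilon}{2}\right)$, or if $\kappa>0$ and $a\tau\epsilon\notin\left(\frac{4\tau^2\epsilon}{\kappa}-\frac{\epsilon}{2},\frac{2\tau^2\epsilon}{\kappa}\right]\cup\left[\frac{2\tau^2\epsilon}{\kappa},\frac{\epsilon}{2}\right)$, then $\mathcal{F}_{a,H}$ does not contain a tube, regardless of the value of the mean curvature $H$.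
   Context: Generalized trigonometric functions: $\mathrm{sn}_\kappa(r)=\frac{1}{\sqrt\kappa}\sin(\sqrt\kappa r)$, $r$, $\frac1{\sqrt{-\kappa}}\sinh(\sqrt{-\kappa}r)$ and $\mathrm{cs}_\kappa(r)=\cos(\sqrt\kappa r)$, $1$, $\cosh(\sqrt{-\kappa}r)$ for $\kappa>0$, $\kappa=0$, $\kappa<0$ respectively; $\mathrm{ct}_\kappa=\mathrm{cs}_\kappa/\mathrm{sn}_\kappa$. Let $I_\kappa=(0,\pi/\sqrt\kappa)$ for $\kappa>0$ and $I_\kappa=(0,\infty)$ for $\kappa\le0$. $\mathbb{E}(\kappa,\tau)$ is represented by coordinates $(r,\theta,z)$, $r\in I_\kappa$, $\theta$ an angle mod $2\pi$, $z\in\mathbb{R}$, with metric $g=dr^2+\mathrm{sn}_\kappa^2(r)\,d\theta^2+\big(4\tau\,\mathrm{sn}_\kappa^2(\tfrac r2)\,d\theta-dz\big)^2$ (for $\kappa\le0$: $\mathbb{E}(\kappa,\tau)$ without the fiber over $r=0$; for $\kappa>0$: the fiber-wise universal covering without the fibers over the two poles). $G_a=\{L_{a,\varphi}:\varphi\in\mathbb{R}\}$ with $L_{a,\varphi}(r,\theta,z)=(r,\theta+\varphi,z+a\varphi)$ is the group of screw motions of pitch $a$. With $h=z-a\theta$, a curve $\gamma=(r,h)$ in $I_\kappa\times\mathbb{R}$ generates the $G_a$-invariant surface $\{(r(t),\varphi,h(t)+a\varphi)\}$. A $G_a$-invariant surface of constant mean curvature $H$ is generated by a (maximal) solution $\gamma=(r,h,\sigma)$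 of $$r'=\cos\sigma,\quad h'=\sqrt{\tfrac{\mathrm{sn}_\kappa^2(r)+(4\tau\,\mathrm{sn}_\kappa^2(r/2)-a)^2}{\mathrm{sn}_\kappa^2(r)}}\,\sin\sigma,\quad 2H=\mathrm{ct}_\kappa(r)\sin\sigma+\sigma'.$$ Along solutions the energy $J=\frac{2H}{\kappa}(\mathrm{cs}_\kappa(r)-1)+\mathrm{sn}_\kappa(r)\sin\sigma$ (for $\kappa=0$: $J=-Hr^2+r\sin\sigma$) is constant, and up to vertical translation and reparametrization the solution is determined by $J$. The family $\mathcal{F}_{a,H}$ is the family of the resulting surfaces $\Sigma_{a,H,J}$, parameterized by $J$; the relevant energies for tubes are $J\in(-\infty,0)$ if $\kappa\le0$ and $J\in(-\frac{4H}{\kappa},0)$ if $\kappa>0$. For these energies $\sigma$ is strictly increasing and unbounded, so $h$ can be regarded as a function of $\sigma$, and the vertical period $\Delta=h(\sigma+2\pi)-h(\sigma)$ is independent of $\sigma$. The surface $\Sigma_{a,H,J}$ is called a tube if its energy $J$ lies in this range and $\Delta=0$ (equivalently, its profile curve in the $(r,h)$-plane is a simple loop). *)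

theory Defs
  imports "HOL-Analysis.Analysis"
begin

definition sn :: "real \<Rightarrow> real \<Rightarrow> real" where
  "sn \<kappa> r = (if \<kappa> > 0 then sin (sqrt \<kappa> * r) / sqrt \<kappa>
             else if \<kappa> = 0 then r
             else sinh (sqrt (- \<kappa>) * r) / sqrt (- \<kappa>))"

definition cs :: "real \<Rightarrow> real \<Rightarrow> real" where
  "cs \<kappa> r = (if \<kappa> > 0 then cos (sqrt \<kappa> * r)
             else if \<kappa> = 0 then 1
             else cosh (sqrt (- \<kappa>) * r))"

definition ct :: "real \<Rightarrow> real \<Rightarrow> real" where
  "ct \<kappa> r = cs \<kappa> r / sn \<kappa> r"

definition radii :: "real \<Rightarrow> real set" where
  "radii \<kappa> = (if \<kappa> > 0 then {0<..<pi / sqrt \<kappa>} else {0<..})"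

text \<open>
  A point with coordinates \<open>(r, \<theta>, z)\<close> is encoded as \<open>(r, cis \<theta>, z)\<close>, so that the angle
  is taken modulo \<open>2\<pi>\<close>. The metric
  \<open>dr\<^sup>2 + sn\<^sup>2(r) d\<theta>\<^sup>2 + (4\<tau> sn\<^sup>2(r/2) d\<theta> - dz)\<^sup>2\<close> enters through the profile
  equations below, which say that the generated surface has constant mean curvature \<open>H\<close>.
\<close>

type_synonym point = "real \<times> complex \<times> real"

definition screw_motion :: "real \<Rightarrow> real \<Rightarrow> point \<Rightarrow> point" where
  "screw_motion a \<phi> = (\<lambda>(r, u, z). (r, cis \<phi> * u, z + a * \<phi>))"

definition generated_surface ::
    "real \<Rightarrow> real set \<Rightarrow> (real \<Rightarrow> real) \<Rightarrow> (real \<Rightarrow> real) \<Rightarrow> point set" where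
  "generated_surface a T r h = {screw_motion a \<phi> (r t, 1, h t) | \<phi> t. t \<in> T}"

text \<open>In the triples below, \<open>(r, h, \<sigma>)\<close> is the profile curve with its angle and \<open>T\<close> the
  parameter interval; values outside \<open>T\<close> are irrelevant.\<close>

definition profile_solution ::
    "real \<Rightarrow> real \<Rightarrow> real \<Rightarrow> real \<Rightarrow> real set \<Rightarrow> (real \<Rightarrow> real) \<Rightarrow> (real \<Rightarrow> real) \<Rightarrow> (real \<Rightarrow> real) \<Rightarrow> bool"
  where
  "profile_solution \<kappa> \<tau> a H T r h \<sigma> \<longleftrightarrow>
     open T \<and> is_interval T \<and> T \<noteq> {} \<and>
     (\<forall>t\<in>T. r t \<in> radii \<kappa> \<and>
        (r has_real_derivative cos (\<sigma> t)) (at t) \<and>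
        (h has_real_derivative
           sqrt (((sn \<kappa> (r t))\<^sup>2 + (4 * \<tau> * (sn \<kappa> (r t / 2))\<^sup>2 - a)\<^sup>2) / (sn \<kappa> (r t))\<^sup>2)
           * sin (\<sigma> t)) (at t) \<and>
        (\<exists>\<sigma>'. (\<sigma> has_real_derivative \<sigma>') (at t) \<and>
              2 * H = ct \<kappa> (r t) * sin (\<sigma> t) + \<sigma>'))"

definition maximal_profile_solution ::
    "real \<Rightarrow> real \<Rightarrow> real \<Rightarrow> real \<Rightarrow> real set \<Rightarrow> (real \<Rightarrow> real) \<Rightarrow> (real \<Rightarrow> real) \<Rightarrow> (real \<Rightarrow> real) \<Rightarrow> bool"
  where
  "maximal_profile_solution \<kappa> \<tau> a H T r h \<sigma> \<longleftrightarrow>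
     profile_solution \<kappa> \<tau> a H T r h \<sigma> \<and>
     (\<forall>T' r' h' \<sigma>'. profile_solution \<kappa> \<tau> a H T' r' h' \<sigma>' \<and> T \<subseteq> T' \<and>
        (\<forall>t\<in>T. r' t = r t \<and> h' t = h t \<and> \<sigma>' t = \<sigma> t) \<longrightarrow> T' = T)"

text \<open>The first integral of the profile equations.\<close>

definition energy :: "real \<Rightarrow> real \<Rightarrow> real \<Rightarrow> real \<Rightarrow> real" where
  "energy \<kappa> H r \<sigma> =
     (if \<kappa> = 0 then - H * r\<^sup>2 + r * sin \<sigma>
      else 2 * H / \<kappa> * (cs \<kappa> r - 1) + sn \<kappa> r * sin \<sigma>)"

text \<open>\<open>generates \<kappa> \<tau> a H J T r h \<sigma> S\<close>: the profile \<open>(r, h, \<sigma>)\<close> exhibits \<open>S\<close> as the surface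
  \<open>\<Sigma>\<^bsub>a,H,J\<^esub>\<close> (which is unique only up to vertical translation).\<close>

definition generates ::
    "real \<Rightarrow> real \<Rightarrow> real \<Rightarrow> real \<Rightarrow> real \<Rightarrow> real set \<Rightarrow> (real \<Rightarrow> real) \<Rightarrow> (real \<Rightarrow> real) \<Rightarrow> (real \<Rightarrow> real)
      \<Rightarrow> point set \<Rightarrow> bool"
  where
  "generates \<kappa> \<tau> a H J T r h \<sigma> S \<longleftrightarrow>
     maximal_profile_solution \<kappa> \<tau> a H T r h \<sigma> \<and>
     (\<forall>t\<in>T. energy \<kappa> H (r t) (\<sigma> t) = J) \<and>
     S = generated_surface a T r h"

definition invariant_cmc_family :: "real \<Rightarrow> real \<Rightarrow> real \<Rightarrow> real \<Rightarrow> point set set" where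
  "invariant_cmc_family \<kappa> \<tau> a H = {S. \<exists>J T r h \<sigma>. generates \<kappa> \<tau> a H J T r h \<sigma> S}"

definition tube_energies :: "real \<Rightarrow> real \<Rightarrow> real set" where
  "tube_energies \<kappa> H = (if \<kappa> > 0 then {- (4 * H / \<kappa>)<..<0} else {..<0})"

text \<open>For energies in the tube range, \<open>\<sigma>\<close> maps \<open>T\<close> bijectively onto the whole line, so that
  \<open>h\<close> becomes a function of the angle; its increment over a full turn does not depend on the
  angle \<open>s\<close> at which the turn starts.\<close>

definition height_at_angle :: "real set \<Rightarrow> (real \<Rightarrow> real) \<Rightarrow> (real \<Rightarrow> real) \<Rightarrow> real \<Rightarrow> real" where
  "height_at_angle T h \<sigma> s = h (the_inv_into T \<sigma> s)"

definition has_vertical_period :: "real set \<Rightarrow> (real \<Rightarrow> real) \<Rightarrow> (real \<Rightarrow> real) \<Rightarrow> real \<Rightarrow> bool" where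
  "has_vertical_period T h \<sigma> \<Delta> \<longleftrightarrow>
     (\<forall>s. height_at_angle T h \<sigma> (s + 2 * pi) - height_at_angle T h \<sigma> s = \<Delta>)"

definition is_tube :: "real \<Rightarrow> real \<Rightarrow> real \<Rightarrow> real \<Rightarrow> point set \<Rightarrow> bool" where
  "is_tube \<kappa> \<tau> a H S \<longleftrightarrow>
     (\<exists>J T r h \<sigma>. generates \<kappa> \<tau> a H J T r h \<sigma> S \<and> J \<in> tube_energies \<kappa> H \<and>
        has_vertical_period T h \<sigma> 0)"

end

theory Submission
  imports Defs
begin

text \<open>
  Let \<open>x = tan (\<surd>\<kappa> r / 2) / \<surd>\<kappa>\<close> (\<open>r / 2\<close> for \<open>\<kappa> = 0\<close>, a hyperbolic tangent for \<open>\<kappa> < 0\<close>). Whatever the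
  sign of \<open>\<kappa>\<close>, both \<open>sn \<kappa> r\<close> and \<open>u = 4 (sn \<kappa> (r/2))\<^sup>2\<close> are the same rational functions of \<open>x\<close>
  and \<open>\<kappa>\<close>, and the energy relation \<open>J = - p\<close> becomes the quadratic equation
  \<open>(4H - \<kappa>p) x\<^sup>2 - 2 x sin \<sigma> - p = 0\<close>. For tube energies it has exactly one positive root \<open>X \<sigma>\<close>:
  the angle alone determines the radius. With \<open>W = \<surd>(sin\<^sup>2 \<sigma> + p (4H - \<kappa>p))\<close> the profile equations
  reduce to \<open>\<sigma>' = W / sn\<close> and \<open>dh/d\<sigma> = N sin \<sigma> / W\<close>, where \<open>N\<close> is the length of the Killing field
  of the screw motions. Integrating, every profile solution of energy \<open>- p\<close> is, up to translations in
  time and height, a piece of one solution on the whole line. So maximal solutions are global,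
  \<open>\<sigma>\<close> is a bijection onto the reals, and the vertical period is the integral of
  \<open>N sin \<sigma> / W\<close> over \<open>[- \<pi>, \<pi>]\<close> (\<open>generates_has_vertical_period\<close>). A tube exists exactly if this
  integral vanishes for some \<open>p\<close> in the tube range.

  The sign of the integral is found by pairing \<open>\<sigma>\<close> with \<open>- \<sigma>\<close>. The square of \<open>N\<close> is
  \<open>a\<^sup>2 + (1 - 2a\<tau>) u - (\<delta>/4) u\<^sup>2\<close> with \<open>\<delta> = \<kappa> - 4\<tau>\<^sup>2\<close>, and the values of \<open>u\<close> at the two paired
  angles have the sum \<open>4 (2pH + S) / (4H\<^sup>2 + \<kappa>S)\<close>, \<open>S = sin\<^sup>2 \<sigma>\<close>. Hence, with \<open>m = (1 - 2a\<tau>) / \<delta>\<close>,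
  the two angles together contribute a positive multiple of \<open>\<delta>\<close> times
  \<open>m (4H\<^sup>2 + \<kappa>S) - (2pH + S)\<close> (\<open>height_rate_add_reflect\<close>). This balance is affine in \<open>S\<close>, so that its
  signs at \<open>S = 0\<close> and \<open>S = 1\<close> decide (\<open>vertical_period_sign\<close>), and it decreases in \<open>p\<close>.

  The hypotheses of the theorem amount to bounds on \<open>m\<close>. If \<open>m \<le> 0\<close>, or \<open>\<kappa> > 0\<close> and \<open>m \<ge> 2/\<kappa>\<close>, the
  balance keeps one sign for all tube energies and there is no tube (\<open>vertical_period_nonzero\<close>).
  In the three existence cases \<open>m (4H\<^sup>2 + \<kappa>) > 1\<close>, which makes the balance positive for small \<open>p\<close>; and
  for \<open>\<kappa> > 0\<close> also \<open>(2/\<kappa> - m) (4H\<^sup>2 + \<kappa>) > 1\<close>, which makes it negative for \<open>p\<close> near \<open>4H/\<kappa>\<close>. For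
  \<open>\<kappa> \<le> 0\<close> it is negative for large \<open>p\<close>. Since the period depends continuously on \<open>p\<close>, it has a zero
  (\<open>vertical_period_zero_exists\<close>).
\<close>

section \<open>The half-angle tangent as radial coordinate\<close>

text \<open>
  In the sphere of curvature \<open>\<kappa>\<close> this is the squared Euclidean length of the chord from the pole
  to a point at distance \<open>r\<close>. The energy and the metric depend on \<open>r\<close> only through it and \<open>sn\<close>.
\<close>
definition chord_sq :: "real \<Rightarrow> real \<Rightarrow> real" where
  "chord_sq \<kappa> r = 4 * (sn \<kappa> (r / 2))\<^sup>2"

text \<open>
  The values of \<open>sn\<close>, \<open>chord_sq\<close> and \<open>r\<close> as functions of the half-angle tangent \<open>x\<close>; the first two
  do not distinguish the sign of \<open>\<kappa>\<close>.
\<close>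
definition sn_of_tan :: "real \<Rightarrow> real \<Rightarrow> real" where
  "sn_of_tan \<kappa> x = 2 * x / (1 + \<kappa> * x\<^sup>2)"

definition chord_of_tan :: "real \<Rightarrow> real \<Rightarrow> real" where
  "chord_of_tan \<kappa> x = 4 * x\<^sup>2 / (1 + \<kappa> * x\<^sup>2)"

definition radius_of_tan :: "real \<Rightarrow> real \<Rightarrow> real" where
  "radius_of_tan \<kappa> x =
     (if \<kappa> > 0 then 2 * arctan (sqrt \<kappa> * x) / sqrt \<kappa>
      else if \<kappa> = 0 then 2 * x
      else 2 * artanh (sqrt (- \<kappa>) * x) / sqrt (- \<kappa>))"

text \<open>
  The half-angle formula for the cosine. It is what makes the separate formula for the energy at
  \<open>\<kappa> = 0\<close> the same expression as for \<open>\<kappa> \<noteq> 0\<close> (\<open>energy_eq\<close>).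
\<close>
lemma cs_eq_chord_sq: "cs \<kappa> r = 1 - \<kappa> / 2 * chord_sq \<kappa> r"
proof -
  have "cos (sqrt \<kappa> * r) = 1 - 2 * (sin (sqrt \<kappa> * (r / 2)))\<^sup>2"
    using cos_double_sin[of "sqrt \<kappa> * (r / 2)"] by simp
  moreover have "cosh (sqrt (- \<kappa>) * r) = 1 + 2 * (sinh (sqrt (- \<kappa>) * (r / 2)))\<^sup>2"
    using cosh_double_cosh[of "sqrt (- \<kappa>) * (r / 2)"] by (simp add: cosh_square_eq)
  ultimately show ?thesis
    by (auto simp: cs_def chord_sq_def sn_def power_divide)
qed

lemma sn_sq_eq_chord_sq: "(sn \<kappa> r)\<^sup>2 = chord_sq \<kappa> r - \<kappa> / 4 * (chord_sq \<kappa> r)\<^sup>2"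
proof (cases "\<kappa> = 0")
  case True
  then show ?thesis by (simp add: sn_def chord_sq_def power_divide)
next
  case False
  have "(cs \<kappa> r)\<^sup>2 + \<kappa> * (sn \<kappa> r)\<^sup>2 = 1"
    using False by (auto simp: cs_def sn_def power_divide cosh_square_eq)
  then have "\<kappa> * (sn \<kappa> r)\<^sup>2 = \<kappa> * (chord_sq \<kappa> r - \<kappa> / 4 * (chord_sq \<kappa> r)\<^sup>2)"
    unfolding cs_eq_chord_sq by (simp add: power2_eq_square algebra_simps)
  with False show ?thesis by simp
qed

lemma energy_eq: "energy \<kappa> H r \<sigma> = sn \<kappa> r * sin \<sigma> - H * chord_sq \<kappa> r"
  by (simp add: energy_def cs_eq_chord_sq) (simp add: chord_sq_def sn_def power_divide)

lemma half_mem_radii: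
  assumes "r \<in> radii \<kappa>"
  shows "r / 2 \<in> radii \<kappa>"
proof -
  have "r / 2 < r" if "r > 0" using that by simp
  with assms show ?thesis
    unfolding radii_def by (auto split: if_splits simp del: divide_less_eq_numeral1)
qed

lemma sn_pos:
  assumes "r \<in> radii \<kappa>"
  shows "sn \<kappa> r > 0"
proof (cases "\<kappa> > 0")
  case True
  then have "0 < sqrt \<kappa> * r" "sqrt \<kappa> * r < pi"
    using assms by (simp_all add: radii_def pos_less_divide_eq mult.commute[of r])
  then show ?thesis using True by (simp add: sn_def sin_gt_zero)
qed (use assms in \<open>auto simp: radii_def sn_def\<close>)

lemma chord_sq_pos: "r \<in> radii \<kappa> \<Longrightarrow> chord_sq \<kappa> r > 0"
  using sn_pos[OF half_mem_radii] by (force simp: chord_sq_def)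

lemma chord_sq_inj:
  assumes "r \<in> radii \<kappa>" "r' \<in> radii \<kappa>" "chord_sq \<kappa> r = chord_sq \<kappa> r'"
  shows "r = r'"
proof -
  have eq: "sn \<kappa> (r / 2) = sn \<kappa> (r' / 2)"
  proof (rule power2_eq_imp_eq)
    show "(sn \<kappa> (r / 2))\<^sup>2 = (sn \<kappa> (r' / 2))\<^sup>2"
      using assms(3) by (simp add: chord_sq_def)
  qed (use assms(1,2) in \<open>auto intro!: less_imp_le sn_pos half_mem_radii\<close>)
  consider "\<kappa> > 0" | "\<kappa> = 0" | "\<kappa> < 0" by linarith
  then show ?thesis
  proof cases
    case 1
    have *: "- (pi / 2) \<le> sqrt \<kappa> * (\<rho> / 2) \<and> sqrt \<kappa> * (\<rho> / 2) \<le> pi / 2" if "\<rho> \<in> radii \<kappa>" for \<rho>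
    proof -
      have "0 < \<rho> * sqrt \<kappa>" "\<rho> * sqrt \<kappa> < pi"
        using that 1 by (simp_all add: radii_def pos_less_divide_eq)
      then show ?thesis using pi_gt_zero by (simp add: mult.commute[of \<rho>])
    qed
    have "sin (sqrt \<kappa> * (r / 2)) = sin (sqrt \<kappa> * (r' / 2))"
      using 1 eq by (simp add: sn_def)
    then have "sqrt \<kappa> * (r / 2) = sqrt \<kappa> * (r' / 2)"
      using *[OF assms(1)] *[OF assms(2)] sin_inj_pi by blast
    with 1 show ?thesis by simp
  qed (use eq in \<open>auto simp: sn_def\<close>)
qed

text \<open>
  Half-angle substitution: \<open>chord_sq / (2 sn)\<close> is \<open>sn (r/2) / cs (r/2)\<close>, the half-angle tangent. The
  quotient avoids the half angle, and everything follows from the relation of \<open>sn\<^sup>2\<close> to \<open>chord_sq\<close>.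
\<close>
lemma sn_chord_of_radius:
  assumes r: "r \<in> radii \<kappa>"
  defines "x \<equiv> chord_sq \<kappa> r / (2 * sn \<kappa> r)"
  shows "x > 0" "1 + \<kappa> * x\<^sup>2 > 0" "sn \<kappa> r = sn_of_tan \<kappa> x" "chord_sq \<kappa> r = chord_of_tan \<kappa> x"
proof -
  define u s where us: "u = chord_sq \<kappa> r" "s = sn \<kappa> r"
  have u: "u > 0" and s: "s > 0"
    using chord_sq_pos[OF r] sn_pos[OF r] us by auto
  have x: "x = u / (2 * s)" by (simp add: x_def us)
  have su: "s\<^sup>2 = u - \<kappa> / 4 * u\<^sup>2"
    using sn_sq_eq_chord_sq by (simp add: us)
  have den: "1 + \<kappa> * x\<^sup>2 = u / s\<^sup>2"
  proof -
    have "1 + \<kappa> * x\<^sup>2 = (s\<^sup>2 + \<kappa> / 4 * u\<^sup>2) / s\<^sup>2"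
      using s by (simp add: x add_divide_distrib power_divide power_mult_distrib)
    also have "s\<^sup>2 + \<kappa> / 4 * u\<^sup>2 = u" by (simp add: su)
    finally show ?thesis .
  qed
  show "x > 0" "1 + \<kappa> * x\<^sup>2 > 0" using u s by (simp_all only: den) (simp_all add: x)
  show "sn \<kappa> r = sn_of_tan \<kappa> x"  "chord_sq \<kappa> r = chord_of_tan \<kappa> x"
    unfolding sn_of_tan_def chord_of_tan_def den us(1,2)[symmetric] using u s
    by (simp_all add: x power2_eq_square)
qed

text \<open>
  The converse substitution. The condition \<open>1 + \<kappa> x\<^sup>2 > 0\<close> restricts \<open>x\<close> only for \<open>\<kappa> < 0\<close>, where the
  hyperbolic tangent stays below 1.
\<close>
lemma radius_of_tan_props:
  assumes "x > 0" and "1 + \<kappa> * x\<^sup>2 > 0"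
  shows "radius_of_tan \<kappa> x \<in> radii \<kappa>"
    and "sn \<kappa> (radius_of_tan \<kappa> x) = sn_of_tan \<kappa> x"
    and "chord_sq \<kappa> (radius_of_tan \<kappa> x) = chord_of_tan \<kappa> x"
    and "(radius_of_tan \<kappa> has_real_derivative 2 / (1 + \<kappa> * x\<^sup>2)) (at x)"
proof -
  have "radius_of_tan \<kappa> x \<in> radii \<kappa> \<and> sn \<kappa> (radius_of_tan \<kappa> x) = sn_of_tan \<kappa> x
      \<and> chord_sq \<kappa> (radius_of_tan \<kappa> x) = chord_of_tan \<kappa> x
      \<and> (radius_of_tan \<kappa> has_real_derivative 2 / (1 + \<kappa> * x\<^sup>2)) (at x)"
  proof -
    consider "\<kappa> > 0" | "\<kappa> = 0" | "\<kappa> < 0" by linarith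
    then show ?thesis
    proof cases
      case 1
      define k where "k = sqrt \<kappa>"
      have k: "k > 0" "\<kappa> = k\<^sup>2" using 1 by (auto simp: k_def)
      have R: "radius_of_tan \<kappa> = (\<lambda>x. 2 * arctan (k * x) / k)"
        using 1 by (auto simp: radius_of_tan_def k_def)
      have "arctan (k * x) < pi / 2" "arctan (k * x) > 0"
        using arctan_ubound k assms by auto
      then have "radius_of_tan \<kappa> x \<in> radii \<kappa>"
        using k 1 unfolding R by (simp add: radii_def divide_strict_right_mono)
      moreover have "sn \<kappa> (radius_of_tan \<kappa> x) = sn_of_tan \<kappa> x"
      proof -
        have "sn \<kappa> (radius_of_tan \<kappa> x) = sin (2 * arctan (k * x)) / k"
          using 1 k(1) by (simp add: sn_def R k_def[symmetric])
        also have "\<dots> = sn_of_tan \<kappa> x"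
          using k assms unfolding sin_double sin_arctan cos_arctan sn_of_tan_def
          by (simp add: power_mult_distrib)
        finally show ?thesis .
      qed
      moreover have "chord_sq \<kappa> (radius_of_tan \<kappa> x) = chord_of_tan \<kappa> x"
        using 1 k(1) assms k(2)[symmetric]
        by (simp add: chord_sq_def sn_def R sin_arctan chord_of_tan_def power_divide power_mult_distrib
            k_def[symmetric])
      moreover have "(radius_of_tan \<kappa> has_real_derivative 2 / (1 + \<kappa> * x\<^sup>2)) (at x)"
      proof -
        have "((\<lambda>x. 2 * arctan (k * x) / k) has_real_derivative
            2 * (inverse (1 + (k * x)\<^sup>2) * (k * 1)) / k) (at x)"
          by (intro DERIV_cdivide DERIV_cmult DERIV_chain2[OF DERIV_arctan] DERIV_ident)
        then show ?thesis unfolding R using k(1)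
          by (simp add: k(2) power_mult_distrib inverse_eq_divide)
      qed
      ultimately show ?thesis by blast
    next
      case 2
      then have R: "radius_of_tan \<kappa> = (\<lambda>x. 2 * x)" by (auto simp: radius_of_tan_def)
      show ?thesis unfolding R using 2 assms
        by (auto simp: radii_def sn_def sn_of_tan_def chord_sq_def chord_of_tan_def power_divide
            intro!: derivative_eq_intros)
    next
      case 3
      define k where "k = sqrt (- \<kappa>)"
      have k: "k > 0" "\<kappa> = - k\<^sup>2" using 3 by (auto simp: k_def)
      have R: "radius_of_tan \<kappa> = (\<lambda>x. 2 * artanh (k * x) / k)"
        using 3 by (auto simp: radius_of_tan_def k_def)
      have "(k * x)\<^sup>2 < 1" using assms(2) by (simp add: k power_mult_distrib)
      then have y: "0 < k * x" "k * x < 1"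
        using k assms(1) by (auto simp: power2_less_1_iff abs_square_less_1)
      \<comment> \<open>By definition \<open>artanh (k x) = ln z / 2\<close>, so hyperbolic functions of \<open>k r\<close> are rational in \<open>z\<close>.\<close>
      define z where "z = (1 + k * x) / (1 - k * x)"
      have z: "z > 1" using y by (simp add: z_def)
      have zz: "(z - inverse z) / 2 = 2 * (k * x) / (1 - (k * x)\<^sup>2)"
          "(z + inverse z) / 2 = (1 + (k * x)\<^sup>2) / (1 - (k * x)\<^sup>2)"
      proof -
        have *: "1 - (k * x)\<^sup>2 = (1 - k * x) * (1 + k * x)" "1 - k * x \<noteq> 0" "1 + k * x \<noteq> 0"
          using y by (auto simp: algebra_simps power2_eq_square)
        have half: "2 * b / d / 2 = b / d" for b d :: real by simp
        have "z - inverse z = 2 * (2 * (k * x)) / (1 - (k * x)\<^sup>2)"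
          "z + inverse z = 2 * (1 + (k * x)\<^sup>2) / (1 - (k * x)\<^sup>2)"
          unfolding z_def *(1) inverse_divide add_frac_eq[OF *(2,3)] diff_frac_eq[OF *(2,3)]
          by (rule arg_cong2[where f = divide]; simp add: power2_eq_square algebra_simps)+
        then show "(z - inverse z) / 2 = 2 * (k * x) / (1 - (k * x)\<^sup>2)"
          "(z + inverse z) / 2 = (1 + (k * x)\<^sup>2) / (1 - (k * x)\<^sup>2)"
          by (simp_all only: half)
      qed
      have kR: "k * radius_of_tan \<kappa> x = ln z"
        using k(1) by (simp add: R artanh_def z_def)
      have "radius_of_tan \<kappa> x > 0"
        using kR z k by (metis ln_gt_zero zero_less_mult_pos)
      then have "radius_of_tan \<kappa> x \<in> radii \<kappa>"
        using 3 by (simp add: radii_def)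
      moreover have "sn \<kappa> (radius_of_tan \<kappa> x) = sn_of_tan \<kappa> x"
      proof -
        have "sn \<kappa> (radius_of_tan \<kappa> x) = sinh (k * radius_of_tan \<kappa> x) / k"
          using 3 by (simp add: sn_def k_def)
        also have "\<dots> = (z - inverse z) / 2 / k"
          unfolding kR using z by (simp add: sinh_ln_real)
        also have "\<dots> = sn_of_tan \<kappa> x"
          using k(1) by (simp add: zz sn_of_tan_def k(2) power_mult_distrib)
        finally show ?thesis .
      qed
      moreover have "chord_sq \<kappa> (radius_of_tan \<kappa> x) = chord_of_tan \<kappa> x"
      proof -
        have "1 - \<kappa> / 2 * chord_sq \<kappa> (radius_of_tan \<kappa> x) = cosh (k * radius_of_tan \<kappa> x)"
          using 3 unfolding cs_eq_chord_sq[symmetric] by (simp add: cs_def k_def)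
        also have "\<dots> = (z + inverse z) / 2"
          unfolding kR using z by (simp add: cosh_ln_real)
        also have "\<dots> = 1 - \<kappa> / 2 * chord_of_tan \<kappa> x"
        proof -
          have "1 - \<kappa> / 2 * chord_of_tan \<kappa> x = (1 - \<kappa> * x\<^sup>2) / (1 + \<kappa> * x\<^sup>2)"
            using assms(2) by (simp add: chord_of_tan_def field_simps)
          then show ?thesis by (simp add: zz k(2) power_mult_distrib)
        qed
        finally show ?thesis using 3 by simp
      qed
      moreover have "(radius_of_tan \<kappa> has_real_derivative 2 / (1 + \<kappa> * x\<^sup>2)) (at x)"
      proof -
        have "((\<lambda>x. 2 * artanh (k * x) / k) has_real_derivative
            2 * (1 / (1 - (k * x)\<^sup>2) * (k * 1)) / k) (at x)"
          using y by (intro DERIV_cdivide DERIV_cmult DERIV_chain2[OF artanh_real_has_field_derivative]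
              DERIV_ident) auto
        then show ?thesis unfolding R using k(1) by (simp add: k(2) power_mult_distrib)
      qed
      ultimately show ?thesis by blast
    qed
  qed
  then show "radius_of_tan \<kappa> x \<in> radii \<kappa>"
    and "sn \<kappa> (radius_of_tan \<kappa> x) = sn_of_tan \<kappa> x"
    and "chord_sq \<kappa> (radius_of_tan \<kappa> x) = chord_of_tan \<kappa> x"
    and "(radius_of_tan \<kappa> has_real_derivative 2 / (1 + \<kappa> * x\<^sup>2)) (at x)"
    by auto
qed

section \<open>The radius as a function of the angle\<close>

definition disc_root :: "real \<Rightarrow> real \<Rightarrow> real \<Rightarrow> real \<Rightarrow> real" where
  "disc_root \<kappa> H p \<theta> = sqrt ((sin \<theta>)\<^sup>2 + p * (4 * H - \<kappa> * p))"

text \<open>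
  The positive root \<open>x\<close> of \<open>(4H - \<kappa>p) x\<^sup>2 - 2 x sin \<theta> - p = 0\<close>; \<open>disc_root\<close> is the square root of its
  reduced discriminant.
\<close>
definition half_tan :: "real \<Rightarrow> real \<Rightarrow> real \<Rightarrow> real \<Rightarrow> real" where
  "half_tan \<kappa> H p \<theta> = (sin \<theta> + disc_root \<kappa> H p \<theta>) / (4 * H - \<kappa> * p)"

text \<open>
  The length, at half-angle tangent \<open>x\<close>, of the Killing field generating the screw motions of
  pitch \<open>a\<close>.
\<close>
definition killing_norm :: "real \<Rightarrow> real \<Rightarrow> real \<Rightarrow> real \<Rightarrow> real" where
  "killing_norm \<kappa> \<tau> a x = sqrt ((sn_of_tan \<kappa> x)\<^sup>2 + (\<tau> * chord_of_tan \<kappa> x - a)\<^sup>2)"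

text \<open>
  The derivative of the height with respect to the angle along a profile of energy \<open>- p\<close>.
\<close>
definition height_rate :: "real \<Rightarrow> real \<Rightarrow> real \<Rightarrow> real \<Rightarrow> real \<Rightarrow> real \<Rightarrow> real" where
  "height_rate \<kappa> \<tau> a H p \<theta> =
     killing_norm \<kappa> \<tau> a (half_tan \<kappa> H p \<theta>) * sin \<theta> / disc_root \<kappa> H p \<theta>"

text \<open>
  The energy is written \<open>- p\<close>; the last two assumptions describe the tube range
  (see \<open>tube_energy_iff\<close>).
\<close>
locale tube_energy =
  fixes \<kappa> H p :: real
  assumes H_pos: "H > 0" and H_large: "4 * H\<^sup>2 + \<kappa> > 0"
    and p_pos: "p > 0" and p_less: "\<kappa> * p < 4 * H"
begin

abbreviation "K \<equiv> 4 * H - \<kappa> * p"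
abbreviation "W \<equiv> disc_root \<kappa> H p"
abbreviation "X \<equiv> half_tan \<kappa> H p"

lemma K_pos: "K > 0"
  using p_less by simp

lemma W_sq: "(W \<theta>)\<^sup>2 = (sin \<theta>)\<^sup>2 + p * K"
  using p_pos p_less by (simp add: disc_root_def)

lemma W_greater: "\<bar>sin \<theta>\<bar> < W \<theta>"
  using p_pos K_pos unfolding disc_root_def by (intro real_less_rsqrt) simp

lemma W_pos: "W \<theta> > 0"
  using W_greater[of \<theta>] by linarith

lemma X_pos: "X \<theta> > 0"
  using W_greater[of \<theta>] K_pos by (simp add: half_tan_def abs_less_iff)

lemma K_X: "K * X \<theta> = sin \<theta> + W \<theta>"
  using K_pos by (simp add: half_tan_def)

lemma X_quadratic: "K * (X \<theta>)\<^sup>2 = 2 * X \<theta> * sin \<theta> + p"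
proof -
  have "K * (K * (X \<theta>)\<^sup>2) = K * (2 * X \<theta> * sin \<theta> + p)"
  proof -
    have "K * (K * (X \<theta>)\<^sup>2) = (sin \<theta> + W \<theta>)\<^sup>2"
      unfolding K_X[symmetric] by (simp add: power2_eq_square)
    also have "\<dots> = 2 * sin \<theta> * (sin \<theta> + W \<theta>) + p * K"
      using W_sq[of \<theta>] by (simp add: power2_eq_square algebra_simps)
    also have "\<dots> = K * (2 * X \<theta> * sin \<theta> + p)"
      unfolding K_X[symmetric] by (simp add: algebra_simps)
    finally show ?thesis .
  qed
  then show ?thesis using K_pos by simp
qed

text \<open>
  The other root is negative, because the product of the roots is \<open>- p / (4H - \<kappa>p)\<close>.
\<close>
lemma X_unique:
  assumes "x > 0" and "K * x\<^sup>2 = 2 * x * sin \<theta> + p"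
  shows "x = X \<theta>"
proof -
  have "2 * x * (K * x - sin \<theta>) = K * x\<^sup>2 + p"
    using assms(2) by (simp add: power2_eq_square algebra_simps)
  moreover have "K * x\<^sup>2 + p > 0" using K_pos p_pos by (simp add: add_nonneg_pos)
  ultimately have "K * x - sin \<theta> > 0"
    using assms(1) by (metis mult_pos_pos zero_less_mult_pos zero_less_numeral)
  moreover have "(K * x - sin \<theta>)\<^sup>2 = (W \<theta>)\<^sup>2"
  proof -
    have "(K * x - sin \<theta>)\<^sup>2 = K * (K * x\<^sup>2 - 2 * x * sin \<theta>) + (sin \<theta>)\<^sup>2"
      by (simp add: power2_eq_square algebra_simps)
    then show ?thesis unfolding assms(2) W_sq by simp
  qed
  ultimately have "K * x - sin \<theta> = W \<theta>"
    using W_pos[of \<theta>] by (simp add: power2_eq_iff_nonneg)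
  then have "K * x = K * X \<theta>" unfolding K_X by simp
  then show ?thesis using K_pos by simp
qed

text \<open>
  This is where \<open>4H\<^sup>2 + \<kappa> > 0\<close> is essential: for \<open>\<kappa> < 0\<close> it keeps the profile away from the ideal
  boundary of the hyperbolic plane. If \<open>1 + \<kappa> X\<^sup>2\<close> were not positive, the quadratic equation would give
  \<open>2 H X \<le> sin \<theta> \<le> 1\<close>, hence \<open>(4H\<^sup>2 + \<kappa>) X\<^sup>2 \<le> 0\<close>.
\<close>
lemma X_den_pos: "1 + \<kappa> * (X \<theta>)\<^sup>2 > 0"
proof (rule ccontr)
  assume "\<not> 1 + \<kappa> * (X \<theta>)\<^sup>2 > 0"
  then have le: "1 + \<kappa> * (X \<theta>)\<^sup>2 \<le> 0" by simp
  have "4 * H * (X \<theta>)\<^sup>2 = 2 * X \<theta> * sin \<theta> + p * (1 + \<kappa> * (X \<theta>)\<^sup>2)"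
    using X_quadratic[of \<theta>] by (simp add: algebra_simps)
  also have "\<dots> \<le> 2 * X \<theta> * 1 + 0"
    using X_pos[of \<theta>] le p_pos by (intro add_mono mult_left_mono mult_nonneg_nonpos) auto
  finally have "2 * X \<theta> * (2 * H * X \<theta>) \<le> 2 * X \<theta> * 1"
    by (simp add: power2_eq_square algebra_simps)
  then have "2 * H * X \<theta> \<le> 1"
    using X_pos[of \<theta>] by (metis mult_le_cancel_left_pos mult_pos_pos zero_less_numeral)
  then have "(2 * H * X \<theta>)\<^sup>2 \<le> 1"
    using H_pos X_pos[of \<theta>] by (intro power_le_one) auto
  with le have "(4 * H\<^sup>2 + \<kappa>) * (X \<theta>)\<^sup>2 \<le> 0"
    by (simp add: power_mult_distrib algebra_simps)
  moreover have "(4 * H\<^sup>2 + \<kappa>) * (X \<theta>)\<^sup>2 > 0"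
    using H_large X_pos[of \<theta>] by simp
  ultimately show False by simp
qed

lemma sn_of_X_pos: "sn_of_tan \<kappa> (X \<theta>) > 0"
  using X_pos X_den_pos by (simp add: sn_of_tan_def)

text \<open>
  Divided by \<open>sn\<close>, this says that \<open>\<sigma>' = W / sn\<close> is the value that the curvature equation
  \<open>2H = ct sin \<sigma> + \<sigma>'\<close> prescribes.
\<close>
lemma angle_speed:
  "2 * H * sn_of_tan \<kappa> (X \<theta>) = (1 - \<kappa> / 2 * chord_of_tan \<kappa> (X \<theta>)) * sin \<theta> + W \<theta>"
proof -
  define d where "d = 1 + \<kappa> * (X \<theta>)\<^sup>2"
  have d: "d > 0" using X_den_pos by (simp add: d_def)
  have W: "W \<theta> = K * X \<theta> - sin \<theta>" by (simp add: K_X)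
  have "(1 - \<kappa> / 2 * chord_of_tan \<kappa> (X \<theta>)) * sin \<theta> + W \<theta> =
      ((d - 2 * \<kappa> * (X \<theta>)\<^sup>2) * sin \<theta> + d * W \<theta>) / d"
    using d by (simp add: chord_of_tan_def d_def[symmetric] field_simps)
  also have "(d - 2 * \<kappa> * (X \<theta>)\<^sup>2) * sin \<theta> + d * W \<theta> =
      K * X \<theta> + \<kappa> * X \<theta> * (K * (X \<theta>)\<^sup>2 - 2 * X \<theta> * sin \<theta>)"
    unfolding W d_def by (simp add: power2_eq_square algebra_simps)
  also have "\<dots> = 4 * H * X \<theta>"
    unfolding X_quadratic by (simp add: algebra_simps)
  finally show ?thesis by (simp add: sn_of_tan_def d_def)
qed

lemma X_deriv: "(X has_real_derivative X \<theta> * cos \<theta> / W \<theta>) (at \<theta>)"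
proof -
  have pos: "(sin \<theta>)\<^sup>2 + p * K > 0"
    using W_sq[of \<theta>] W_pos[of \<theta>] by (metis zero_less_power)
  have dW: "(W has_real_derivative sin \<theta> * cos \<theta> / W \<theta>) (at \<theta>)"
    unfolding disc_root_def[abs_def] using pos
    by (auto intro!: derivative_eq_intros simp: divide_simps)
  have "(X has_real_derivative (cos \<theta> + sin \<theta> * cos \<theta> / W \<theta>) / K) (at \<theta>)"
    unfolding half_tan_def[abs_def] by (intro DERIV_cdivide DERIV_add DERIV_sin dW)
  also have "(cos \<theta> + sin \<theta> * cos \<theta> / W \<theta>) / K = X \<theta> * cos \<theta> / W \<theta>"
    using W_pos[of \<theta>] K_pos by (simp add: half_tan_def field_simps)
  finally show ?thesis .
qed

lemma W_minus [simp]: "W (- \<theta>) = W \<theta>"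
  by (simp add: disc_root_def)

text \<open>
  The common denominator of the two paired values of \<open>chord_sq\<close>; being affine in \<open>sin\<^sup>2 \<theta>\<close>, it lies
  between the positive numbers \<open>4H\<^sup>2\<close> and \<open>4H\<^sup>2 + \<kappa>\<close>.
\<close>
lemma weight_pos: "4 * H\<^sup>2 + \<kappa> * (sin \<theta>)\<^sup>2 > 0"
proof (cases "\<kappa> \<ge> 0")
  case True
  then show ?thesis using H_pos by (simp add: add_pos_nonneg)
next
  case False
  then have "\<kappa> * 1 \<le> \<kappa> * (sin \<theta>)\<^sup>2"
    by (intro mult_left_mono_neg) (auto simp: abs_square_le_1)
  then show ?thesis using H_large by simp
qed

text \<open>
  For fixed \<open>sin\<^sup>2 \<theta>\<close> the two values of \<open>chord_sq\<close> at \<open>\<theta>\<close> and \<open>- \<theta>\<close> are the roots of the quadratic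
  equation obtained by squaring the energy relation, and this is its sum of roots. The proof
  uses \<open>K X (\<plusminus>\<theta>) = W \<theta> \<plusminus> sin \<theta>\<close>, so that \<open>X \<theta> X (- \<theta>) = p / K\<close>.
\<close>
lemma chord_of_add_reflect:
  "(chord_of_tan \<kappa> (X \<theta>) + chord_of_tan \<kappa> (X (- \<theta>))) * (4 * H\<^sup>2 + \<kappa> * (sin \<theta>)\<^sup>2)
     = 4 * (2 * p * H + (sin \<theta>)\<^sup>2)"
proof -
  define A B S where "A = (X \<theta>)\<^sup>2" and "B = (X (- \<theta>))\<^sup>2" and "S = (sin \<theta>)\<^sup>2"
  have dA: "1 + \<kappa> * A > 0" and dB: "1 + \<kappa> * B > 0"
    using X_den_pos by (auto simp: A_def B_def)
  have prod: "K * (X \<theta> * X (- \<theta>)) = p"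
  proof -
    have "K * (K * (X \<theta> * X (- \<theta>))) = (K * X \<theta>) * (K * X (- \<theta>))" by simp
    also have "\<dots> = (W \<theta>)\<^sup>2 - (sin \<theta>)\<^sup>2"
      unfolding K_X by (simp add: power2_eq_square algebra_simps)
    finally have "K * (K * (X \<theta> * X (- \<theta>))) = K * p" unfolding W_sq by simp
    then show ?thesis using K_pos by simp
  qed
  have AB: "K\<^sup>2 * (A * B) = p\<^sup>2"
  proof -
    have "K\<^sup>2 * (A * B) = (K * (X \<theta> * X (- \<theta>)))\<^sup>2"
      by (simp add: A_def B_def power_mult_distrib)
    then show ?thesis unfolding prod .
  qed
  have ApB: "K\<^sup>2 * (A + B) = 4 * S + 2 * p * K"
  proof -
    have "K\<^sup>2 * (A + B) = (K * X \<theta>)\<^sup>2 + (K * X (- \<theta>))\<^sup>2"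
      by (simp add: A_def B_def power_mult_distrib distrib_left)
    also have "\<dots> = 2 * (sin \<theta>)\<^sup>2 + 2 * (W \<theta>)\<^sup>2"
      unfolding K_X by (simp add: power2_eq_square algebra_simps)
    finally show ?thesis unfolding W_sq S_def by simp
  qed
  have sum: "chord_of_tan \<kappa> (X \<theta>) + chord_of_tan \<kappa> (X (- \<theta>)) =
      4 * (A + B + 2 * \<kappa> * (A * B)) / ((1 + \<kappa> * A) * (1 + \<kappa> * B))"
    using dA dB by (simp add: chord_of_tan_def A_def[symmetric] B_def[symmetric] field_simps)
  have num: "K\<^sup>2 * (A + B + 2 * \<kappa> * (A * B)) = 4 * (2 * p * H + S)"
  proof -
    have "K\<^sup>2 * (A + B + 2 * \<kappa> * (A * B)) = K\<^sup>2 * (A + B) + 2 * \<kappa> * (K\<^sup>2 * (A * B))"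
      by (simp add: algebra_simps)
    then show ?thesis unfolding AB ApB by (simp add: power2_eq_square algebra_simps)
  qed
  have den: "K\<^sup>2 * ((1 + \<kappa> * A) * (1 + \<kappa> * B)) = 4 * (4 * H\<^sup>2 + \<kappa> * S)"
  proof -
    have "K\<^sup>2 * ((1 + \<kappa> * A) * (1 + \<kappa> * B)) = K\<^sup>2 + \<kappa> * (K\<^sup>2 * (A + B)) + \<kappa>\<^sup>2 * (K\<^sup>2 * (A * B))"
      by (simp add: algebra_simps power2_eq_square)
    then show ?thesis unfolding AB ApB by (simp add: power2_eq_square algebra_simps)
  qed
  have "(chord_of_tan \<kappa> (X \<theta>) + chord_of_tan \<kappa> (X (- \<theta>))) * (4 * (4 * H\<^sup>2 + \<kappa> * S))
     = 4 * (K\<^sup>2 * (A + B + 2 * \<kappa> * (A * B)))"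
    unfolding sum den[symmetric] using dA dB K_pos by simp
  then show ?thesis unfolding num S_def by (simp add: algebra_simps)
qed

end

section \<open>Primitives and inverse functions\<close>

lemma ex_antiderivative:
  fixes f :: "real \<Rightarrow> real"
  assumes "continuous_on UNIV f"
  shows "\<exists>F. \<forall>x. (F has_real_derivative f x) (at x)"
  using einterval_antiderivative[of "-\<infinity>" "\<infinity>" f] assms
  by (auto simp: continuous_on_eq_continuous_at has_real_derivative_iff_has_vector_derivative)

text \<open>
  The lower bound on the derivative makes the function surjective, by the intermediate value theorem.
\<close>
lemma ex_differentiable_inverse:
  fixes T :: "real \<Rightarrow> real"
  assumes T: "\<And>x. (T has_real_derivative f x) (at x)" and c: "c > 0" and f: "\<And>x. c \<le> f x"
  shows "\<exists>G. (\<forall>x. G (T x) = x) \<and> (\<forall>t. T (G t) = t)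
    \<and> (\<forall>t. (G has_real_derivative inverse (f (G t))) (at t))"
proof -
  have f_pos: "f x > 0" for x using c f[of x] by linarith
  have less: "T x < T y" if "x < y" for x y
    using that T f_pos by (intro DERIV_pos_imp_increasing[of x y T]) auto
  then have inj: "inj T"
    by (intro injI) (metis less_irrefl linorder_neqE)
  have growth: "T x - c * x \<le> T y - c * y" if "x \<le> y" for x y
  proof (rule DERIV_nonneg_imp_nondecreasing[OF that])
    fix z
    have "((\<lambda>x. T x - c * x) has_real_derivative f z - c) (at z)"
      by (auto intro!: derivative_eq_intros T)
    with f[of z] show "\<exists>y. ((\<lambda>x. T x - c * x) has_real_derivative y) (at z) \<and> 0 \<le> y"
      by (intro exI[of _ "f z - c"]) auto
  qed
  have cont: "isCont T x" for x using T by (rule DERIV_isCont)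
  have surj: "\<exists>x. T x = y" for y
  proof -
    define A where "A = \<bar>y - T 0\<bar> / c"
    have A: "A \<ge> 0" "c * A = \<bar>y - T 0\<bar>" using c by (auto simp: A_def)
    have "T (- A) \<le> y" "y \<le> T A"
      using growth[of "- A" 0] growth[of 0 A] A by auto
    then show ?thesis
      using IVT'[of T "- A" y A] A(1) cont by (auto intro: continuous_at_imp_continuous_on)
  qed
  define G where "G = inv T"
  have GT: "G (T x) = x" for x using inj by (simp add: G_def)
  have TG: "T (G t) = t" for t using surj[of t] by (auto simp: GT)
  have "(G has_real_derivative inverse (f (G t))) (at t)" for t
  proof (rule DERIV_inverse_function[OF T])
    show "f (G t) \<noteq> 0" using f_pos[of "G t"] by simp
    show "t - 1 < t" "t < t + 1" by auto
    have "isCont G (T (G t))"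
      by (rule isCont_inverse_function[of 1]) (auto simp: GT cont)
    then show "isCont G t" by (simp add: TG)
  qed (simp add: TG)
  with GT TG show ?thesis by blast
qed

lemma eq_plus_const_of_deriv_eq:
  fixes f g :: "real \<Rightarrow> real"
  assumes "convex T"
    and f: "\<And>t. t \<in> T \<Longrightarrow> (f has_real_derivative v t) (at t)"
    and g: "\<And>t. t \<in> T \<Longrightarrow> (g has_real_derivative v t) (at t)"
  shows "\<exists>c. \<forall>t\<in>T. f t = c + g t"
proof -
  have "\<exists>c. \<forall>t\<in>T. f t - g t = c"
  proof (rule has_field_derivative_zero_constant[OF \<open>convex T\<close>])
    fix t assume "t \<in> T"
    then have "((\<lambda>t. f t - g t) has_real_derivative v t - v t) (at t)"
      by (intro DERIV_diff f g)
    then show "((\<lambda>t. f t - g t) has_real_derivative 0) (at t within T)"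
      by (simp add: has_field_derivative_at_within)
  qed
  then show ?thesis by (metis diff_add_cancel)
qed

section \<open>The profile with given energy\<close>

definition vertical_period :: "real \<Rightarrow> real \<Rightarrow> real \<Rightarrow> real \<Rightarrow> real \<Rightarrow> real" where
  "vertical_period \<kappa> \<tau> a H p = integral {- pi..pi} (height_rate \<kappa> \<tau> a H p)"

text \<open>
  Joint continuity in energy and angle; it makes the period continuous in the energy.
\<close>
lemma continuous_height_rate_energy_angle:
  assumes "H > 0" "4 * H\<^sup>2 + \<kappa> > 0"
  shows "continuous_on ({p. 0 < p \<and> \<kappa> * p < 4 * H} \<times> UNIV)
    (\<lambda>(p, \<theta>). height_rate \<kappa> \<tau> a H p \<theta>)"
proof -
  have te: "tube_energy \<kappa> H p" if "0 < p" "\<kappa> * p < 4 * H" for p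
    using assms that by (simp add: tube_energy_def)
  have "4 * H - \<kappa> * p \<noteq> 0" "disc_root \<kappa> H p \<theta> \<noteq> 0" "1 + \<kappa> * (half_tan \<kappa> H p \<theta>)\<^sup>2 \<noteq> 0"
    if "0 < p" "\<kappa> * p < 4 * H" for p \<theta>
    using tube_energy.W_pos[OF te[OF that], of \<theta>] tube_energy.X_den_pos[OF te[OF that], of \<theta>] that
    by auto
  then show ?thesis
    unfolding height_rate_def killing_norm_def sn_of_tan_def chord_of_tan_def case_prod_unfold
    unfolding half_tan_def disc_root_def
    by (intro continuous_intros) auto
qed

context tube_energy
begin

text \<open>
  The derivative of the time with respect to the angle.
\<close>
definition time_rate :: "real \<Rightarrow> real" where
  "time_rate \<theta> = sn_of_tan \<kappa> (X \<theta>) / W \<theta>"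

lemma time_rate_pos: "time_rate \<theta> > 0"
  using sn_of_X_pos W_pos by (simp add: time_rate_def)

lemma continuous_time_rate: "continuous_on UNIV time_rate"
proof -
  have X: "continuous_on UNIV X"
    using X_deriv by (meson DERIV_isCont continuous_at_imp_continuous_on)
  have W: "continuous_on UNIV W"
    unfolding disc_root_def[abs_def] by (intro continuous_intros)
  show ?thesis
    unfolding time_rate_def[abs_def] sn_of_tan_def
    using W_pos X_den_pos by (intro continuous_intros X W) (auto simp: less_imp_neq[symmetric])
qed

text \<open>
  The rate depends on the angle only through its sine, so its minimum over one half turn bounds it
  everywhere. Thus time and angle run through the whole line together.
\<close>
lemma time_rate_bounded_below: "\<exists>c>0. \<forall>\<theta>. c \<le> time_rate \<theta>"
proof -
  have "\<exists>\<theta>\<^sub>0\<in>{- (pi / 2)..pi / 2}. \<forall>\<theta>\<in>{- (pi / 2)..pi / 2}. time_rate \<theta>\<^sub>0 \<le> time_rate \<theta>"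
    by (rule continuous_attains_inf)
      (use continuous_on_subset[OF continuous_time_rate] in auto)
  then obtain \<theta>\<^sub>0 where \<theta>\<^sub>0:
    "\<And>\<theta>. \<theta> \<in> {- (pi / 2)..pi / 2} \<Longrightarrow> time_rate \<theta>\<^sub>0 \<le> time_rate \<theta>"
    by blast
  have "time_rate \<theta>\<^sub>0 \<le> time_rate \<theta>" for \<theta>
  proof -
    have "sin (arcsin (sin \<theta>)) = sin \<theta>" by (simp add: sin_arcsin)
    then have "time_rate (arcsin (sin \<theta>)) = time_rate \<theta>"
      by (simp add: time_rate_def half_tan_def disc_root_def)
    moreover have "arcsin (sin \<theta>) \<in> {- (pi / 2)..pi / 2}"
      using arcsin_bounded[of "sin \<theta>"] by auto
    ultimately show ?thesis using \<theta>\<^sub>0 by metis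
  qed
  then show ?thesis using time_rate_pos by blast
qed

lemma continuous_height_rate: "continuous_on UNIV (height_rate \<kappa> \<tau> a H p)"
proof -
  have "continuous_on UNIV (\<lambda>\<theta>. case (p, \<theta>) of (p, \<theta>) \<Rightarrow> height_rate \<kappa> \<tau> a H p \<theta>)"
    by (rule continuous_on_compose2[OF continuous_height_rate_energy_angle[OF H_pos H_large]])
      (use p_pos p_less in \<open>auto intro!: continuous_intros\<close>)
  then show ?thesis by simp
qed

text \<open>
  The profile equations with the angle as the independent variable: dividing the rates of \<open>r\<close> and
  \<open>h\<close> by \<open>\<sigma>' = 1 / time_rate\<close> gives rates that depend on the angle alone.
\<close>
lemma profile_rates:
  defines "r \<equiv> (\<lambda>\<theta>. radius_of_tan \<kappa> (X \<theta>))"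
  shows "r \<theta> \<in> radii \<kappa>"
    and "energy \<kappa> H (r \<theta>) \<theta> = - p"
    and "sqrt (((sn \<kappa> (r \<theta>))\<^sup>2 + (4 * \<tau> * (sn \<kappa> (r \<theta> / 2))\<^sup>2 - a)\<^sup>2) / (sn \<kappa> (r \<theta>))\<^sup>2) * sin \<theta>
         = height_rate \<kappa> \<tau> a H p \<theta> * inverse (time_rate \<theta>)"
    and "2 * H = ct \<kappa> (r \<theta>) * sin \<theta> + inverse (time_rate \<theta>)"
    and "(r has_real_derivative cos \<theta> * time_rate \<theta>) (at \<theta>)"
proof -
  note R = radius_of_tan_props[OF X_pos[of \<theta>] X_den_pos[of \<theta>]]
  have s: "sn_of_tan \<kappa> (X \<theta>) > 0" by (rule sn_of_X_pos)
  show "r \<theta> \<in> radii \<kappa>" unfolding r_def by (rule R(1))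
  show "energy \<kappa> H (r \<theta>) \<theta> = - p"
  proof -
    have "2 * X \<theta> * sin \<theta> - 4 * H * (X \<theta>)\<^sup>2 = - p * (1 + \<kappa> * (X \<theta>)\<^sup>2)"
      using X_quadratic[of \<theta>] by (simp add: algebra_simps)
    then have "(2 * X \<theta> * sin \<theta> - 4 * H * (X \<theta>)\<^sup>2) / (1 + \<kappa> * (X \<theta>)\<^sup>2) = - p"
      using X_den_pos[of \<theta>] by simp
    then show ?thesis
      unfolding energy_eq r_def R(2,3) sn_of_tan_def chord_of_tan_def
      by (simp add: diff_divide_distrib mult_ac)
  qed
  show "sqrt (((sn \<kappa> (r \<theta>))\<^sup>2 + (4 * \<tau> * (sn \<kappa> (r \<theta> / 2))\<^sup>2 - a)\<^sup>2) / (sn \<kappa> (r \<theta>))\<^sup>2) * sin \<theta>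
         = height_rate \<kappa> \<tau> a H p \<theta> * inverse (time_rate \<theta>)"
  proof -
    have chord: "4 * \<tau> * (sn \<kappa> (radius_of_tan \<kappa> (X \<theta>) / 2))\<^sup>2 = \<tau> * chord_of_tan \<kappa> (X \<theta>)"
      unfolding R(3)[symmetric] chord_sq_def by simp
    show ?thesis
      unfolding r_def chord R(2) using s W_pos[of \<theta>]
      by (simp add: real_sqrt_divide height_rate_def killing_norm_def time_rate_def)
  qed
  show "2 * H = ct \<kappa> (r \<theta>) * sin \<theta> + inverse (time_rate \<theta>)"
    using angle_speed[of \<theta>] s
    by (simp add: ct_def cs_eq_chord_sq r_def R(2,3) time_rate_def divide_simps)
  have "(r has_real_derivative (2 / (1 + \<kappa> * (X \<theta>)\<^sup>2)) * (X \<theta> * cos \<theta> / W \<theta>)) (at \<theta>)"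
    unfolding r_def by (rule DERIV_chain2[OF R(4) X_deriv])
  then show "(r has_real_derivative cos \<theta> * time_rate \<theta>) (at \<theta>)"
    by (simp add: time_rate_def sn_of_tan_def mult_ac)
qed

lemma radius_of_energy:
  assumes r: "r \<in> radii \<kappa>" and E: "energy \<kappa> H r \<theta> = - p"
  shows "r = radius_of_tan \<kappa> (X \<theta>)"
proof -
  define x where "x = chord_sq \<kappa> r / (2 * sn \<kappa> r)"
  note x = sn_chord_of_radius[OF r, folded x_def]
  have "(2 * x * sin \<theta> - 4 * H * x\<^sup>2) / (1 + \<kappa> * x\<^sup>2) = - p"
    using E unfolding energy_eq x(3,4) sn_of_tan_def chord_of_tan_def by (simp add: diff_divide_distrib mult_ac)
  then have "2 * x * sin \<theta> - 4 * H * x\<^sup>2 = - p * (1 + \<kappa> * x\<^sup>2)"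
    using x(2) by (simp add: divide_eq_eq)
  then have "K * x\<^sup>2 = 2 * x * sin \<theta> + p" by (simp add: algebra_simps)
  with x(1) have X: "x = X \<theta>" by (rule X_unique)
  note R = radius_of_tan_props[OF X_pos[of \<theta>] X_den_pos[of \<theta>]]
  show ?thesis
    using x(4) unfolding X by (intro chord_sq_inj[OF r R(1)]) (simp add: R(3))
qed

text \<open>
  Let \<open>G\<close> give the angle at a time and let \<open>Z\<close> be a primitive of the height rate. Translations in
  time (\<open>c\<close>) and height (\<open>d\<close>) are included so that every solution can be matched.
\<close>
lemma global_profile:
  assumes G: "\<And>t. (G has_real_derivative inverse (time_rate (G t))) (at t)"
    and Z: "\<And>\<theta>. (Z has_real_derivative height_rate \<kappa> \<tau> a H p \<theta>) (at \<theta>)"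
  shows "profile_solution \<kappa> \<tau> a H UNIV
    (\<lambda>t. radius_of_tan \<kappa> (X (G (t - c)))) (\<lambda>t. d + Z (G (t - c))) (\<lambda>t. G (t - c))"
  unfolding profile_solution_def
proof (intro conjI ballI open_UNIV)
  fix t :: real
  let ?\<theta> = "G (t - c)"
  have \<sigma>: "((\<lambda>t. G (t - c)) has_real_derivative inverse (time_rate ?\<theta>)) (at t)"
  proof -
    have "((\<lambda>t. G (t - c)) has_real_derivative inverse (time_rate ?\<theta>) * 1) (at t)"
      by (rule DERIV_chain2[OF G]) (auto intro!: derivative_eq_intros)
    then show ?thesis by simp
  qed
  show "radius_of_tan \<kappa> (X ?\<theta>) \<in> radii \<kappa>" by (rule profile_rates)
  have "((\<lambda>t. radius_of_tan \<kappa> (X (G (t - c)))) has_real_derivative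
      cos ?\<theta> * time_rate ?\<theta> * inverse (time_rate ?\<theta>)) (at t)"
    by (rule DERIV_chain2[OF profile_rates(5) \<sigma>])
  then show "((\<lambda>t. radius_of_tan \<kappa> (X (G (t - c)))) has_real_derivative cos ?\<theta>) (at t)"
    using time_rate_pos[of ?\<theta>] by (simp add: mult.assoc)
  show "((\<lambda>t. d + Z (G (t - c))) has_real_derivative
      sqrt (((sn \<kappa> (radius_of_tan \<kappa> (X ?\<theta>)))\<^sup>2
          + (4 * \<tau> * (sn \<kappa> (radius_of_tan \<kappa> (X ?\<theta>) / 2))\<^sup>2 - a)\<^sup>2)
        / (sn \<kappa> (radius_of_tan \<kappa> (X ?\<theta>)))\<^sup>2) * sin ?\<theta>) (at t)"
    unfolding profile_rates(3)
    using DERIV_add[OF DERIV_const DERIV_chain2[OF Z \<sigma>], of d] by simp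
  show "\<exists>\<sigma>'. ((\<lambda>t. G (t - c)) has_real_derivative \<sigma>') (at t) \<and>
      2 * H = ct \<kappa> (radius_of_tan \<kappa> (X ?\<theta>)) * sin ?\<theta> + \<sigma>'"
    using \<sigma> profile_rates(4) by blast
qed auto

text \<open>
  The radius is determined by the energy; for time and height, the difference from the primitives
  evaluated at the angle has derivative zero on the interval \<open>T\<close>.
\<close>
lemma profile_solution_as_function_of_angle:
  assumes sol: "profile_solution \<kappa> \<tau> a H T r h \<sigma>"
    and E: "\<And>t. t \<in> T \<Longrightarrow> energy \<kappa> H (r t) (\<sigma> t) = - p"
    and A: "\<And>\<theta>. (A has_real_derivative time_rate \<theta>) (at \<theta>)"
    and Z: "\<And>\<theta>. (Z has_real_derivative height_rate \<kappa> \<tau> a H p \<theta>) (at \<theta>)"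
  shows "\<exists>c d. \<forall>t\<in>T. A (\<sigma> t) = t - c \<and> h t = d + Z (\<sigma> t) \<and> r t = radius_of_tan \<kappa> (X (\<sigma> t))"
proof -
  have cT: "convex T" using sol by (simp add: profile_solution_def is_interval_convex_1)
  have r: "r t = radius_of_tan \<kappa> (X (\<sigma> t))" if "t \<in> T" for t
    using sol that E[OF that] by (intro radius_of_energy) (auto simp: profile_solution_def)
  have \<sigma>: "(\<sigma> has_real_derivative inverse (time_rate (\<sigma> t))) (at t)" if t: "t \<in> T" for t
  proof -
    obtain \<sigma>' where \<sigma>': "(\<sigma> has_real_derivative \<sigma>') (at t)"
        "2 * H = ct \<kappa> (r t) * sin (\<sigma> t) + \<sigma>'"
      using sol t unfolding profile_solution_def by blast
    with profile_rates(4)[of "\<sigma> t"] have "\<sigma>' = inverse (time_rate (\<sigma> t))"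
      unfolding r[OF t] by linarith
    with \<sigma>' show ?thesis by simp
  qed
  have "\<exists>c. \<forall>t\<in>T. t = c + A (\<sigma> t)"
  proof (rule eq_plus_const_of_deriv_eq[OF cT DERIV_ident])
    fix t assume "t \<in> T"
    then have "((\<lambda>t. A (\<sigma> t)) has_real_derivative time_rate (\<sigma> t) * inverse (time_rate (\<sigma> t))) (at t)"
      by (intro DERIV_chain2[OF A] \<sigma>)
    then show "((\<lambda>t. A (\<sigma> t)) has_real_derivative 1) (at t)"
      using time_rate_pos[of "\<sigma> t"] by simp
  qed
  moreover have "\<exists>d. \<forall>t\<in>T. h t = d + Z (\<sigma> t)"
  proof (rule eq_plus_const_of_deriv_eq[OF cT])
    fix t assume t: "t \<in> T"
    show "(h has_real_derivative height_rate \<kappa> \<tau> a H p (\<sigma> t) * inverse (time_rate (\<sigma> t))) (at t)"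
      using sol t unfolding profile_solution_def profile_rates(3)[symmetric] r[OF t, symmetric] by blast
    show "((\<lambda>t. Z (\<sigma> t)) has_real_derivative
        height_rate \<kappa> \<tau> a H p (\<sigma> t) * inverse (time_rate (\<sigma> t))) (at t)"
      using t by (intro DERIV_chain2[OF Z] \<sigma>)
  qed
  ultimately obtain c d where "\<forall>t\<in>T. t = c + A (\<sigma> t)" "\<forall>t\<in>T. h t = d + Z (\<sigma> t)" by blast
  then have "\<forall>t\<in>T. A (\<sigma> t) = t - c \<and> h t = d + Z (\<sigma> t) \<and> r t = radius_of_tan \<kappa> (X (\<sigma> t))"
    using r by (metis add_diff_cancel_left')
  then show ?thesis by blast
qed

lemma ex_time_height:
  "\<exists>A G Z. (\<forall>\<theta>. (A has_real_derivative time_rate \<theta>) (at \<theta>))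
    \<and> (\<forall>\<theta>. G (A \<theta>) = \<theta>) \<and> (\<forall>t. A (G t) = t)
    \<and> (\<forall>t. (G has_real_derivative inverse (time_rate (G t))) (at t))
    \<and> (\<forall>\<theta>. (Z has_real_derivative height_rate \<kappa> \<tau> a H p \<theta>) (at \<theta>))"
proof -
  obtain A where A: "\<And>\<theta>. (A has_real_derivative time_rate \<theta>) (at \<theta>)"
    using ex_antiderivative[OF continuous_time_rate] by blast
  obtain c where c: "c > 0" "\<And>\<theta>. c \<le> time_rate \<theta>"
    using time_rate_bounded_below by blast
  obtain G where G: "\<And>\<theta>. G (A \<theta>) = \<theta>" "\<And>t. A (G t) = t"
      "\<And>t. (G has_real_derivative inverse (time_rate (G t))) (at t)"
    using ex_differentiable_inverse[OF A c] by blast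
  obtain Z where Z: "\<And>\<theta>. (Z has_real_derivative height_rate \<kappa> \<tau> a H p \<theta>) (at \<theta>)"
    using ex_antiderivative[OF continuous_height_rate] by blast
  show ?thesis using A G Z by blast
qed

text \<open>
  A solution on the whole line is maximal because no larger set of times exists.
\<close>
lemma ex_generates: "\<exists>T r h \<sigma> S. generates \<kappa> \<tau> a H (- p) T r h \<sigma> S"
proof -
  obtain A G Z where AGZ:
    "\<And>\<theta>. (A has_real_derivative time_rate \<theta>) (at \<theta>)"
    "\<And>\<theta>. G (A \<theta>) = \<theta>" "\<And>t. A (G t) = t"
    "\<And>t. (G has_real_derivative inverse (time_rate (G t))) (at t)"
    "\<And>\<theta>. (Z has_real_derivative height_rate \<kappa> \<tau> a H p \<theta>) (at \<theta>)"
    using ex_time_height[of \<tau> a] by blast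
  have "profile_solution \<kappa> \<tau> a H UNIV
      (\<lambda>t. radius_of_tan \<kappa> (X (G (t - 0)))) (\<lambda>t. 0 + Z (G (t - 0))) (\<lambda>t. G (t - 0))"
    by (rule global_profile[OF AGZ(4,5)])
  then have "maximal_profile_solution \<kappa> \<tau> a H UNIV
      (\<lambda>t. radius_of_tan \<kappa> (X (G t))) (\<lambda>t. Z (G t)) G"
    by (auto simp: maximal_profile_solution_def)
  then show ?thesis
    unfolding generates_def using profile_rates(2) by blast
qed

text \<open>
  A maximal solution coincides on its interval with a solution defined for all times, hence is
  that solution. Then the height as a function of the angle is a primitive of the
  \<open>2\<pi>\<close>-periodic height rate, and its increment over a turn is the integral over \<open>[- \<pi>, \<pi>]\<close>.
\<close>
lemma generates_has_vertical_period:
  assumes gen: "generates \<kappa> \<tau> a H (- p) T r h \<sigma> S"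
  shows "has_vertical_period T h \<sigma> (vertical_period \<kappa> \<tau> a H p)"
proof -
  have max: "maximal_profile_solution \<kappa> \<tau> a H T r h \<sigma>"
    and E: "\<And>t. t \<in> T \<Longrightarrow> energy \<kappa> H (r t) (\<sigma> t) = - p"
    using gen by (auto simp: generates_def)
  then have sol: "profile_solution \<kappa> \<tau> a H T r h \<sigma>"
    by (simp add: maximal_profile_solution_def)
  obtain A G Z where A: "\<And>\<theta>. (A has_real_derivative time_rate \<theta>) (at \<theta>)"
    and GA: "\<And>\<theta>. G (A \<theta>) = \<theta>" and AG: "\<And>t. A (G t) = t"
    and G: "\<And>t. (G has_real_derivative inverse (time_rate (G t))) (at t)"
    and Z: "\<And>\<theta>. (Z has_real_derivative height_rate \<kappa> \<tau> a H p \<theta>) (at \<theta>)"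
    using ex_time_height[of \<tau> a] by blast
  obtain c d where cd: "\<And>t. t \<in> T \<Longrightarrow> A (\<sigma> t) = t - c \<and> h t = d + Z (\<sigma> t)
      \<and> r t = radius_of_tan \<kappa> (X (\<sigma> t))"
    using profile_solution_as_function_of_angle[OF sol E A Z] by blast
  have \<sigma>: "\<sigma> t = G (t - c)" if "t \<in> T" for t
    using cd[OF that] GA by metis
  have T: "T = UNIV"
  proof -
    have "\<forall>t\<in>T. radius_of_tan \<kappa> (X (G (t - c))) = r t \<and> d + Z (G (t - c)) = h t \<and> G (t - c) = \<sigma> t"
      using cd \<sigma> by simp
    then have "UNIV = T"
      using max global_profile[OF G Z, of c d] unfolding maximal_profile_solution_def by blast
    then show ?thesis ..
  qed
  have "inj \<sigma>"
    using \<sigma> AG unfolding T by (intro injI) (metis UNIV_I diff_add_cancel)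
  then have inv: "the_inv_into T \<sigma> s = A s + c" for s
    using \<sigma>[of "A s + c"] unfolding T by (intro the_inv_into_f_eq) (auto simp: GA)
  have height: "height_at_angle T h \<sigma> s = d + Z s" for s
    unfolding height_at_angle_def inv
    using cd[of "A s + c"] \<sigma>[of "A s + c"] by (simp add: T GA)
  have "Z (s + 2 * pi) - Z s = vertical_period \<kappa> \<tau> a H p" for s
  proof -
    have per: "height_rate \<kappa> \<tau> a H p (s + 2 * pi) = height_rate \<kappa> \<tau> a H p s" for s
      by (simp add: height_rate_def half_tan_def disc_root_def)
    have "((\<lambda>s. Z (s + 2 * pi) - Z s) has_real_derivative 0) (at s)" for s
    proof -
      have "((\<lambda>s. Z (s + 2 * pi)) has_real_derivative height_rate \<kappa> \<tau> a H p (s + 2 * pi) * 1) (at s)"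
        by (rule DERIV_chain2[OF Z]) (auto intro!: derivative_eq_intros)
      from DERIV_diff[OF this Z] show ?thesis by (simp add: per)
    qed
    then have "Z (s + 2 * pi) - Z s = Z (- pi + 2 * pi) - Z (- pi)"
      using DERIV_isconst_all[of "\<lambda>s. Z (s + 2 * pi) - Z s" s "- pi"] by blast
    also have "\<dots> = vertical_period \<kappa> \<tau> a H p"
    proof -
      have "(height_rate \<kappa> \<tau> a H p has_integral Z pi - Z (- pi)) {- pi..pi}"
        using Z by (intro fundamental_theorem_of_calculus)
          (auto simp: has_real_derivative_iff_has_vector_derivative[symmetric]
            intro: has_field_derivative_at_within)
      then show ?thesis by (simp add: vertical_period_def integral_unique)
    qed
    finally show ?thesis .
  qed
  then show ?thesis by (simp add: has_vertical_period_def height)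
qed

end

section \<open>The sign of the vertical period\<close>

text \<open>
  For a primitive \<open>F\<close> of \<open>f\<close>, the function \<open>F x - F (- x)\<close> has derivative \<open>f x + f (- x)\<close>, so it
  increases from 0 to the integral.
\<close>
lemma integral_symmetric_pos:
  fixes f :: "real \<Rightarrow> real"
  assumes cont: "continuous_on UNIV f" and "b > 0"
    and pos: "\<And>x. 0 < x \<Longrightarrow> x < b \<Longrightarrow> f x + f (- x) > 0"
  shows "integral {- b..b} f > 0"
proof -
  obtain F where F: "\<And>x. (F has_real_derivative f x) (at x)"
    using ex_antiderivative[OF cont] by blast
  have deriv: "((\<lambda>x. F x - F (- x)) has_real_derivative f x + f (- x)) (at x)" for x
  proof -
    have "((\<lambda>x. F (- x)) has_real_derivative f (- x) * - 1) (at x)"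
      by (rule DERIV_chain2[OF F]) (auto intro!: derivative_eq_intros)
    from DERIV_diff[OF F this] show ?thesis by simp
  qed
  have "F 0 - F (- 0) < F b - F (- b)"
  proof (rule DERIV_pos_imp_increasing_open[OF \<open>b > 0\<close>, of "\<lambda>x. F x - F (- x)"])
    show "continuous_on {0..b} (\<lambda>x. F x - F (- x))"
      using deriv by (meson DERIV_isCont continuous_at_imp_continuous_on)
  qed (use deriv pos in blast)
  moreover have "(f has_integral F b - F (- b)) {- b..b}"
    using F \<open>b > 0\<close> by (intro fundamental_theorem_of_calculus)
      (auto simp: has_real_derivative_iff_has_vector_derivative[symmetric]
        intro: has_field_derivative_at_within)
  ultimately show ?thesis by (simp add: integral_unique)
qed

text \<open>
  With \<open>m = (1 - 2a\<tau>) / \<delta>\<close> and \<open>S = sin\<^sup>2 \<theta>\<close>, the sign of \<open>\<delta> * balance\<close> is that of the joint height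
  contribution of \<open>\<theta>\<close> and \<open>- \<theta>\<close>.
\<close>
definition balance :: "real \<Rightarrow> real \<Rightarrow> real \<Rightarrow> real \<Rightarrow> real \<Rightarrow> real" where
  "balance \<kappa> H m p S = m * (4 * H\<^sup>2 + \<kappa> * S) - (2 * p * H + S)"

context tube_energy
begin

text \<open>
  Since \<open>W\<close> is even and the sine is odd, the sum is \<open>sin \<theta> / W\<close> times the difference \<open>P - Q\<close> of the
  Killing field lengths at \<open>\<theta>\<close> and \<open>- \<theta>\<close>, which has the sign of \<open>P\<^sup>2 - Q\<^sup>2\<close>. As the squared length is
  quadratic in \<open>chord_sq\<close>, that difference is \<open>u - v > 0\<close> times an expression involving only the sum \<open>u + v\<close>.
\<close>
lemma height_rate_add_reflect:
  fixes \<tau> a :: real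
  defines "\<delta> \<equiv> \<kappa> - 4 * \<tau>\<^sup>2"
  assumes "\<delta> \<noteq> 0" and \<theta>: "0 < \<theta>" "\<theta> < pi"
  shows "\<exists>c>0. height_rate \<kappa> \<tau> a H p \<theta> + height_rate \<kappa> \<tau> a H p (- \<theta>)
    = c * (\<delta> * balance \<kappa> H ((1 - 2 * a * \<tau>) / \<delta>) p ((sin \<theta>)\<^sup>2))"
proof -
  define u v where "u = chord_of_tan \<kappa> (X \<theta>)" and "v = chord_of_tan \<kappa> (X (- \<theta>))"
  define w where "w = 4 * H\<^sup>2 + \<kappa> * (sin \<theta>)\<^sup>2"
  define P Q where "P = killing_norm \<kappa> \<tau> a (X \<theta>)" and "Q = killing_norm \<kappa> \<tau> a (X (- \<theta>))"
  define B where "B = balance \<kappa> H ((1 - 2 * a * \<tau>) / \<delta>) p ((sin \<theta>)\<^sup>2)"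
  have sin: "sin \<theta> > 0" using \<theta> by (rule sin_gt_zero)
  have w: "w > 0" unfolding w_def by (rule weight_pos)
  have sn_sq: "(sn_of_tan \<kappa> (X \<phi>))\<^sup>2 = chord_of_tan \<kappa> (X \<phi>) - \<kappa> / 4 * (chord_of_tan \<kappa> (X \<phi>))\<^sup>2" for \<phi>
  proof -
    note R = radius_of_tan_props[OF X_pos[of \<phi>] X_den_pos[of \<phi>]]
    show ?thesis using sn_sq_eq_chord_sq[of \<kappa> "radius_of_tan \<kappa> (X \<phi>)"] unfolding R(2,3) .
  qed
  have norm_pos: "killing_norm \<kappa> \<tau> a (X \<phi>) > 0" for \<phi>
    using sn_of_X_pos[of \<phi>] by (simp add: killing_norm_def add_pos_nonneg)
  have norm_sq: "(killing_norm \<kappa> \<tau> a (X \<phi>))\<^sup>2 =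
      a\<^sup>2 + (1 - 2 * a * \<tau>) * chord_of_tan \<kappa> (X \<phi>) - \<delta> / 4 * (chord_of_tan \<kappa> (X \<phi>))\<^sup>2" for \<phi>
  proof -
    have "(killing_norm \<kappa> \<tau> a (X \<phi>))\<^sup>2 = (sn_of_tan \<kappa> (X \<phi>))\<^sup>2 + (\<tau> * chord_of_tan \<kappa> (X \<phi>) - a)\<^sup>2"
      by (simp add: killing_norm_def)
    then show ?thesis
      unfolding sn_sq by (simp add: \<delta>_def power2_eq_square algebra_simps diff_divide_distrib)
  qed
  have "u > v"
  proof -
    have "K * X \<theta> > K * X (- \<theta>)" unfolding K_X using sin by simp
    then have "X (- \<theta>) < X \<theta>" using K_pos by simp
    then have "(X (- \<theta>))\<^sup>2 < (X \<theta>)\<^sup>2" using X_pos[of "- \<theta>"] by (intro power_strict_mono) auto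
    then show ?thesis
      using X_den_pos[of \<theta>] X_den_pos[of "- \<theta>"]
      by (simp add: u_def v_def chord_of_tan_def frac_less_eq divide_simps algebra_simps)
  qed
  have "(P\<^sup>2 - Q\<^sup>2) * w = (u - v) * (\<delta> * B)"
  proof -
    have diff: "P\<^sup>2 - Q\<^sup>2 = (u - v) * ((1 - 2 * a * \<tau>) - \<delta> / 4 * (u + v))"
      unfolding P_def Q_def norm_sq u_def v_def by (simp add: power2_eq_square algebra_simps)
    have "(P\<^sup>2 - Q\<^sup>2) * w = (u - v) * ((1 - 2 * a * \<tau>) * w - \<delta> / 4 * ((u + v) * w))"
      unfolding diff by (simp only: left_diff_distrib mult.assoc)
    also have "(u + v) * w = 4 * (2 * p * H + (sin \<theta>)\<^sup>2)"
      unfolding u_def v_def w_def by (rule chord_of_add_reflect)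
    also have "(1 - 2 * a * \<tau>) * w - \<delta> / 4 * (4 * (2 * p * H + (sin \<theta>)\<^sup>2)) = \<delta> * B"
      using \<open>\<delta> \<noteq> 0\<close> by (simp add: B_def balance_def w_def right_diff_distrib)
    finally show ?thesis .
  qed
  moreover have "P\<^sup>2 - Q\<^sup>2 = (P - Q) * (P + Q)"
    by (simp add: power2_eq_square algebra_simps)
  ultimately have "(P - Q) * (w * (P + Q)) = (u - v) * (\<delta> * B)"
    by (simp only: mult_ac)
  moreover have PQ: "P + Q > 0" using norm_pos by (simp add: P_def Q_def add_pos_pos)
  then have "w * (P + Q) \<noteq> 0" using w by simp
  ultimately have "P - Q = (u - v) * (\<delta> * B) / (w * (P + Q))"
    by (simp only: eq_divide_eq) simp
  then have "P - Q = (u - v) / (w * (P + Q)) * (\<delta> * B)"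
    by simp
  moreover have "height_rate \<kappa> \<tau> a H p \<theta> + height_rate \<kappa> \<tau> a H p (- \<theta>) = sin \<theta> / W \<theta> * (P - Q)"
    by (simp add: height_rate_def P_def Q_def right_diff_distrib mult.commute diff_divide_distrib)
  ultimately have "height_rate \<kappa> \<tau> a H p \<theta> + height_rate \<kappa> \<tau> a H p (- \<theta>) =
      (sin \<theta> / W \<theta> * ((u - v) / (w * (P + Q)))) * (\<delta> * B)"
    by simp
  moreover have "sin \<theta> / W \<theta> * ((u - v) / (w * (P + Q))) > 0"
    using sin W_pos \<open>u > v\<close> w PQ by simp
  ultimately show ?thesis unfolding B_def by blast
qed

text \<open>
  The balance is affine in \<open>S\<close>, so its signs at \<open>S = 0\<close> and \<open>S = 1\<close> suffice. The factor \<open>s\<close> treats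
  positive and negative balance together.
\<close>
lemma vertical_period_sign:
  fixes \<tau> a :: real
  defines "\<delta> \<equiv> \<kappa> - 4 * \<tau>\<^sup>2"
  defines "m \<equiv> (1 - 2 * a * \<tau>) / \<delta>"
  assumes "\<delta> \<noteq> 0"
    and "s * balance \<kappa> H m p 0 > 0" "s * balance \<kappa> H m p 1 > 0"
  shows "s * \<delta> * vertical_period \<kappa> \<tau> a H p > 0"
proof -
  let ?f = "height_rate \<kappa> \<tau> a H p"
  have "integral {- pi..pi} (\<lambda>\<theta>. s * \<delta> * ?f \<theta>) > 0"
  proof (rule integral_symmetric_pos)
    show "continuous_on UNIV (\<lambda>\<theta>. s * \<delta> * ?f \<theta>)"
      by (intro continuous_intros continuous_height_rate)
    fix \<theta> :: real assume \<theta>: "0 < \<theta>" "\<theta> < pi"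
    define S where "S = (sin \<theta>)\<^sup>2"
    have S: "0 < S" "S \<le> 1"
      using sin_gt_zero[OF \<theta>] by (auto simp: S_def abs_square_le_1)
    obtain c where c: "c > 0" "?f \<theta> + ?f (- \<theta>) = c * (\<delta> * balance \<kappa> H m p S)"
      using height_rate_add_reflect[OF assms(3)[unfolded \<delta>_def] \<theta>, of a]
      unfolding m_def \<delta>_def S_def by blast
    have "s * balance \<kappa> H m p S = (1 - S) * (s * balance \<kappa> H m p 0) + S * (s * balance \<kappa> H m p 1)"
      by (simp add: balance_def algebra_simps)
    also have "\<dots> > 0"
      using S assms(4,5) by (intro add_nonneg_pos) auto
    finally have "0 < c * \<delta>\<^sup>2 * (s * balance \<kappa> H m p S)"
      using c(1) \<open>\<delta> \<noteq> 0\<close> by simp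
    also have "\<dots> = s * \<delta> * ?f \<theta> + s * \<delta> * ?f (- \<theta>)"
      unfolding distrib_left[symmetric] c(2) by (simp add: power2_eq_square)
    finally show "s * \<delta> * ?f \<theta> + s * \<delta> * ?f (- \<theta>) > 0" .
  qed simp
  then show ?thesis by (simp add: vertical_period_def)
qed

end

section \<open>Tubes and zeros of the vertical period\<close>

lemma tube_energy_iff:
  assumes "H > 0" "4 * H\<^sup>2 + \<kappa> > 0"
  shows "tube_energy \<kappa> H p \<longleftrightarrow> - p \<in> tube_energies \<kappa> H"
proof (cases "\<kappa> > 0")
  case True
  then show ?thesis
    using assms by (auto simp: tube_energy_def tube_energies_def pos_less_divide_eq mult.commute)
next
  case False
  then have "p > 0 \<Longrightarrow> \<kappa> * p < 4 * H"
    using assms(1) by (smt (verit) mult_nonneg_nonneg mult_nonpos_nonneg)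
  with False show ?thesis
    using assms by (auto simp: tube_energy_def tube_energies_def)
qed

lemma tube_exists_iff_vertical_period_zero:
  assumes "H > 0" "4 * H\<^sup>2 + \<kappa> > 0"
  shows "(\<exists>S\<in>invariant_cmc_family \<kappa> \<tau> a H. is_tube \<kappa> \<tau> a H S)
    \<longleftrightarrow> (\<exists>p. tube_energy \<kappa> H p \<and> vertical_period \<kappa> \<tau> a H p = 0)"
proof
  assume "\<exists>S\<in>invariant_cmc_family \<kappa> \<tau> a H. is_tube \<kappa> \<tau> a H S"
  then obtain J T r h \<sigma> S where g: "generates \<kappa> \<tau> a H J T r h \<sigma> S"
    and J: "J \<in> tube_energies \<kappa> H" and 0: "has_vertical_period T h \<sigma> 0"
    unfolding is_tube_def by blast
  have te: "tube_energy \<kappa> H (- J)" using J assms by (simp add: tube_energy_iff)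
  have "has_vertical_period T h \<sigma> (vertical_period \<kappa> \<tau> a H (- J))"
    by (rule tube_energy.generates_has_vertical_period[OF te]) (use g in simp)
  with 0 have "vertical_period \<kappa> \<tau> a H (- J) = 0"
    by (simp add: has_vertical_period_def)
  with te show "\<exists>p. tube_energy \<kappa> H p \<and> vertical_period \<kappa> \<tau> a H p = 0" by blast
next
  assume "\<exists>p. tube_energy \<kappa> H p \<and> vertical_period \<kappa> \<tau> a H p = 0"
  then obtain p where te: "tube_energy \<kappa> H p" and 0: "vertical_period \<kappa> \<tau> a H p = 0" by blast
  obtain T r h \<sigma> S where g: "generates \<kappa> \<tau> a H (- p) T r h \<sigma> S"
    using tube_energy.ex_generates[OF te] by blast
  have "has_vertical_period T h \<sigma> 0"
    using tube_energy.generates_has_vertical_period[OF te g] 0 by simp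
  moreover have "- p \<in> tube_energies \<kappa> H" using te assms by (simp add: tube_energy_iff)
  ultimately have "is_tube \<kappa> \<tau> a H S"
    using g unfolding is_tube_def by blast
  moreover have "S \<in> invariant_cmc_family \<kappa> \<tau> a H"
    using g unfolding invariant_cmc_family_def by blast
  ultimately show "\<exists>S\<in>invariant_cmc_family \<kappa> \<tau> a H. is_tube \<kappa> \<tau> a H S" by blast
qed

text \<open>
  This turns the bounds on \<open>a\<tau>\<epsilon>\<close> into bounds on \<open>m\<close>, whatever the sign of \<open>\<epsilon>\<close>; the factor \<open>c\<close> will be
  \<open>\<epsilon>\<delta> = \<bar>\<delta>\<bar>\<close>.
\<close>
lemma order_iff_of_diff_eq:
  fixes x y c z :: real
  assumes eq: "y - x = c * z / 2" and c: "c > 0"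
  shows "x < y \<longleftrightarrow> 0 < z" "x \<le> y \<longleftrightarrow> 0 \<le> z" "y \<le> x \<longleftrightarrow> z \<le> 0"
proof -
  have "x < y \<longleftrightarrow> 0 < c * z" "x \<le> y \<longleftrightarrow> 0 \<le> c * z" "y \<le> x \<longleftrightarrow> c * z \<le> 0"
    using eq by linarith+
  then show "x < y \<longleftrightarrow> 0 < z" "x \<le> y \<longleftrightarrow> 0 \<le> z" "y \<le> x \<longleftrightarrow> z \<le> 0"
    using c by (simp_all add: zero_less_mult_iff zero_le_mult_iff mult_le_0_iff)
qed

text \<open>
  Small \<open>p\<close> makes the balance positive, by \<open>low\<close>. For \<open>\<kappa> > 0\<close> the reflection \<open>p = 4H/\<kappa> - q\<close>, \<open>m = 2/\<kappa> - n\<close>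
  (exchanging the two poles) turns the balance into its negative, so small \<open>q\<close> makes it negative, by
  \<open>high\<close>. The intermediate value theorem gives the zero in between.
\<close>
lemma vertical_period_zero_exists:
  fixes \<kappa> \<tau> a H :: real
  defines "\<delta> \<equiv> \<kappa> - 4 * \<tau>\<^sup>2"
  defines "m \<equiv> (1 - 2 * a * \<tau>) / \<delta>"
  assumes H: "H > 0" "4 * H\<^sup>2 + \<kappa> > 0" and "\<delta> \<noteq> 0"
    and low: "m * (4 * H\<^sup>2 + \<kappa>) > 1"
    and high: "\<kappa> > 0 \<Longrightarrow> (2 / \<kappa> - m) * (4 * H\<^sup>2 + \<kappa>) > 1"
  shows "\<exists>p. tube_energy \<kappa> H p \<and> vertical_period \<kappa> \<tau> a H p = 0"
proof -
  have pos_of_gt: "x > 0" if "x * (4 * H\<^sup>2 + \<kappa>) > 1" for x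
    using that H(2) by (metis less_trans zero_less_mult_pos2 zero_less_one)
  have small: "\<exists>q>0. q < B \<and> 2 * q * H < x * (4 * H\<^sup>2) \<and> 2 * q * H < x * (4 * H\<^sup>2 + \<kappa>) - 1"
    if x: "x * (4 * H\<^sup>2 + \<kappa>) > 1" and "B > 0" for x B
  proof -
    define M where "M = min B (min (x * (4 * H\<^sup>2) / (2 * H)) ((x * (4 * H\<^sup>2 + \<kappa>) - 1) / (2 * H)))"
    have "M > 0" using x pos_of_gt[OF x] H \<open>B > 0\<close> by (simp add: M_def)
    moreover have "M \<le> B" "M \<le> x * (4 * H\<^sup>2) / (2 * H)" "M \<le> (x * (4 * H\<^sup>2 + \<kappa>) - 1) / (2 * H)"
      by (auto simp: M_def)
    ultimately have "M / 2 > 0" "M / 2 < B" "M / 2 < x * (4 * H\<^sup>2) / (2 * H)"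
        "M / 2 < (x * (4 * H\<^sup>2 + \<kappa>) - 1) / (2 * H)"
      by linarith+
    then have "M / 2 > 0" "M / 2 < B" "M / 2 * (2 * H) < x * (4 * H\<^sup>2)"
        "M / 2 * (2 * H) < x * (4 * H\<^sup>2 + \<kappa>) - 1"
      using H(1) by (simp_all only: pos_less_divide_eq mult_pos_pos zero_less_numeral)
    then show ?thesis by (intro exI[of _ "M / 2"]) (simp add: mult_ac)
  qed
  obtain p\<^sub>0 where p\<^sub>0: "p\<^sub>0 > 0" "balance \<kappa> H m p\<^sub>0 0 > 0" "balance \<kappa> H m p\<^sub>0 1 > 0"
    using small[OF low, of 1] by (auto simp: balance_def)
  obtain p\<^sub>1 where p\<^sub>1: "p\<^sub>1 > 0" "\<kappa> * p\<^sub>1 < 4 * H"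
    "balance \<kappa> H m p\<^sub>1 0 < 0" "balance \<kappa> H m p\<^sub>1 1 < 0"
  proof (cases "\<kappa> > 0")
    case True
    obtain q where q: "q > 0" "q < 4 * H / \<kappa>" "2 * q * H < (2 / \<kappa> - m) * (4 * H\<^sup>2)"
        "2 * q * H < (2 / \<kappa> - m) * (4 * H\<^sup>2 + \<kappa>) - 1"
      using small[OF high[OF True], of "4 * H / \<kappa>"] True H(1) by auto
    show ?thesis
    proof (rule that[of "4 * H / \<kappa> - q"])
      show "4 * H / \<kappa> - q > 0" using q by simp
      show "\<kappa> * (4 * H / \<kappa> - q) < 4 * H" using True q by (simp add: right_diff_distrib)
      have "balance \<kappa> H m (4 * H / \<kappa> - q) 0 = 2 * q * H - (2 / \<kappa> - m) * (4 * H\<^sup>2)"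
        using True by (simp add: balance_def field_simps power2_eq_square)
      with q(3) show "balance \<kappa> H m (4 * H / \<kappa> - q) 0 < 0" by simp
      have "balance \<kappa> H m (4 * H / \<kappa> - q) 1 = 2 * q * H - ((2 / \<kappa> - m) * (4 * H\<^sup>2 + \<kappa>) - 1)"
        using True by (simp add: balance_def field_simps power2_eq_square)
      with q(4) show "balance \<kappa> H m (4 * H / \<kappa> - q) 1 < 0" by simp
    qed
  next
    case False
    \<comment> \<open>For \<open>\<kappa> \<le> 0\<close> every \<open>p > 2 m H\<close> makes the balance negative; \<open>p = M / H = 4 m H\<close> is one.\<close>
    define M where "M = m * (4 * H\<^sup>2)"
    have m: "m > 0" by (rule pos_of_gt[OF low])
    have "M > 0" using m H(1) by (simp add: M_def)
    show ?thesis
    proof (rule that[of "M / H"])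
      show "M / H > 0" using \<open>M > 0\<close> H(1) by simp
      then show "\<kappa> * (M / H) < 4 * H"
        using False H(1) by (smt (verit) mult_nonpos_nonneg)
      have "balance \<kappa> H m (M / H) 0 = - M"
        using H(1) by (simp add: balance_def M_def)
      then show "balance \<kappa> H m (M / H) 0 < 0" using \<open>M > 0\<close> by simp
      have "balance \<kappa> H m (M / H) 1 = - M + m * \<kappa> - 1"
        using H(1) by (simp add: balance_def M_def algebra_simps)
      moreover have "m * \<kappa> \<le> 0" using m False by (simp add: mult_nonneg_nonpos)
      ultimately show "balance \<kappa> H m (M / H) 1 < 0" using \<open>M > 0\<close> by simp
    qed
  qed
  have "2 * H * p\<^sub>0 < 2 * H * p\<^sub>1" using p\<^sub>0(2) p\<^sub>1(3) by (simp add: balance_def mult_ac)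
  then have less: "p\<^sub>0 < p\<^sub>1" using H(1) by simp
  have range: "0 < p \<and> \<kappa> * p < 4 * H" if "p \<in> {p\<^sub>0..p\<^sub>1}" for p
  proof
    show "0 < p" using that p\<^sub>0(1) by simp
    show "\<kappa> * p < 4 * H"
    proof (cases "\<kappa> > 0")
      case True
      then have "\<kappa> * p \<le> \<kappa> * p\<^sub>1" using that by simp
      then show ?thesis using p\<^sub>1(2) by linarith
    next
      case False
      then show ?thesis using \<open>0 < p\<close> H(1) by (smt (verit) mult_nonpos_nonneg)
    qed
  qed
  then have te: "tube_energy \<kappa> H p" if "p \<in> {p\<^sub>0..p\<^sub>1}" for p
    using that H by (auto simp: tube_energy_def)
  let ?f = "\<lambda>p. \<delta> * vertical_period \<kappa> \<tau> a H p"
  have "continuous_on {p\<^sub>0..p\<^sub>1} ?f"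
  proof -
    have "continuous_on ({p\<^sub>0..p\<^sub>1} \<times> cbox (- pi) pi) (\<lambda>(p, \<theta>). height_rate \<kappa> \<tau> a H p \<theta>)"
      by (rule continuous_on_subset[OF continuous_height_rate_energy_angle[OF H]]) (use range in auto)
    from integral_continuous_on_param[OF this] show ?thesis
      unfolding vertical_period_def by (intro continuous_intros) simp
  qed
  moreover have "?f p\<^sub>0 > 0"
    using tube_energy.vertical_period_sign[OF te[of p\<^sub>0], of \<tau> 1 a] less p\<^sub>0 \<open>\<delta> \<noteq> 0\<close>
    by (simp add: m_def \<delta>_def)
  moreover have "- 1 * \<delta> * vertical_period \<kappa> \<tau> a H p\<^sub>1 > 0"
    unfolding \<delta>_def
    by (rule tube_energy.vertical_period_sign[OF te[of p\<^sub>1]])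
      (use less p\<^sub>1 \<open>\<delta> \<noteq> 0\<close> in \<open>simp_all add: m_def \<delta>_def\<close>)
  then have "?f p\<^sub>1 < 0" by simp
  ultimately obtain p where "p \<in> {p\<^sub>0..p\<^sub>1}" "?f p = 0"
    using IVT2'[of ?f p\<^sub>1 0 p\<^sub>0] less by (auto simp: less_imp_le)
  with te \<open>\<delta> \<noteq> 0\<close> show ?thesis by auto
qed

text \<open>
  The balance is negative for all \<open>p\<close> if \<open>m \<le> 0\<close>, and positive up to \<open>p = 4H/\<kappa>\<close> if \<open>m \<ge> 2/\<kappa>\<close>.
\<close>
lemma vertical_period_nonzero:
  fixes \<kappa> \<tau> a H :: real
  defines "\<delta> \<equiv> \<kappa> - 4 * \<tau>\<^sup>2"
  defines "m \<equiv> (1 - 2 * a * \<tau>) / \<delta>"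
  assumes te: "tube_energy \<kappa> H p" and "\<delta> \<noteq> 0"
    and out: "m \<le> 0 \<or> (\<kappa> > 0 \<and> m \<ge> 2 / \<kappa>)"
  shows "vertical_period \<kappa> \<tau> a H p \<noteq> 0"
proof -
  interpret tube_energy \<kappa> H p by (rule te)
  have pH: "p * H > 0" "H * p > 0" using p_pos H_pos by simp_all
  have "\<exists>s. s * balance \<kappa> H m p 0 > 0 \<and> s * balance \<kappa> H m p 1 > 0"
    using out
  proof
    assume "m \<le> 0"
    then have "m * (4 * H\<^sup>2) \<le> 0" "m * (4 * H\<^sup>2 + \<kappa>) \<le> 0"
      using H_large by (auto simp: mult_nonpos_nonneg)
    then show ?thesis using pH by (intro exI[of _ "- 1"]) (simp add: balance_def)
  next
    assume m: "\<kappa> > 0 \<and> m \<ge> 2 / \<kappa>"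
    have "2 * p * H < 2 / \<kappa> * (4 * H\<^sup>2)"
    proof -
      have "2 * H * (\<kappa> * p) < 2 * H * (4 * H)" using p_less H_pos by (intro mult_strict_left_mono) auto
      then show ?thesis using m by (simp add: pos_less_divide_eq power2_eq_square mult_ac)
    qed
    moreover have "2 / \<kappa> * (4 * H\<^sup>2) \<le> m * (4 * H\<^sup>2)" using m by (intro mult_right_mono) auto
    moreover have "2 \<le> m * \<kappa>" using m by (auto simp: pos_divide_le_eq)
    moreover have "balance \<kappa> H m p 0 = m * (4 * H\<^sup>2) - 2 * p * H"
        "balance \<kappa> H m p 1 = m * (4 * H\<^sup>2) - 2 * p * H + (m * \<kappa> - 1)"
      by (simp_all add: balance_def algebra_simps)
    ultimately have "balance \<kappa> H m p 0 > 0" "balance \<kappa> H m p 1 > 0" by linarith+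
    then show ?thesis by (intro exI[of _ 1]) simp
  qed
  then obtain s where "s * balance \<kappa> H m p 0 > 0" "s * balance \<kappa> H m p 1 > 0" by blast
  from vertical_period_sign[OF _ this[unfolded m_def \<delta>_def]] \<open>\<delta> \<noteq> 0\<close>
  show ?thesis by (auto simp: \<delta>_def)
qed

theorem theorem3p6:
  fixes \<kappa> \<tau> a H \<epsilon> :: real
  assumes "\<kappa> - 4 * \<tau>\<^sup>2 \<noteq> 0"
    and "\<epsilon> = sgn (\<kappa> - 4 * \<tau>\<^sup>2)"
    and "H > 0"
    and "4 * H\<^sup>2 + \<kappa> > 0"
  shows
    "((\<kappa> \<le> 0 \<and> a * \<tau> * \<epsilon> \<in> {..<\<epsilon> / 2} \<and>
        H\<^sup>2 > (2 * \<tau>\<^sup>2 - a * \<tau> * \<kappa>) / (4 * a * \<tau> - 2))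
     \<or> (\<kappa> > 0 \<and> a * \<tau> * \<epsilon> \<in> {2 * \<tau>\<^sup>2 * \<epsilon> / \<kappa>..<\<epsilon> / 2} \<and>
        H\<^sup>2 > (2 * \<tau>\<^sup>2 - a * \<tau> * \<kappa>) / (4 * a * \<tau> - 2))
     \<or> (\<kappa> > 0 \<and> a * \<tau> * \<epsilon> \<in> {4 * \<tau>\<^sup>2 * \<epsilon> / \<kappa> - \<epsilon> / 2<..2 * \<tau>\<^sup>2 * \<epsilon> / \<kappa>} \<and>
        H\<^sup>2 > (2 * \<tau>\<^sup>2 - a * \<tau> * \<kappa>) / (4 * a * \<tau> + 2 - 16 * \<tau>\<^sup>2 / \<kappa>))
     \<longrightarrow> (\<exists>S \<in> invariant_cmc_family \<kappa> \<tau> a H. is_tube \<kappa> \<tau> a H S))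
   \<and>
    ((\<kappa> \<le> 0 \<and> a * \<tau> * \<epsilon> \<notin> {..<\<epsilon> / 2})
     \<or> (\<kappa> > 0 \<and> a * \<tau> * \<epsilon> \<notin> {4 * \<tau>\<^sup>2 * \<epsilon> / \<kappa> - \<epsilon> / 2<..2 * \<tau>\<^sup>2 * \<epsilon> / \<kappa>}
                                \<union> {2 * \<tau>\<^sup>2 * \<epsilon> / \<kappa>..<\<epsilon> / 2})
     \<longrightarrow> \<not> (\<exists>S \<in> invariant_cmc_family \<kappa> \<tau> a H. is_tube \<kappa> \<tau> a H S))"
proof -
  define \<delta> where "\<delta> = \<kappa> - 4 * \<tau>\<^sup>2"
  define m where "m = (1 - 2 * a * \<tau>) / \<delta>"
  have \<delta>: "\<delta> \<noteq> 0" and \<epsilon>\<delta>: "\<epsilon> * \<delta> > 0"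
    using assms(1,2) by (auto simp: \<delta>_def sgn_if)
  have m\<delta>: "m * \<delta> = 1 - 2 * a * \<tau>" using \<delta> by (simp add: m_def)
  have upper: "a * \<tau> * \<epsilon> < \<epsilon> / 2 \<longleftrightarrow> 0 < m"
  proof -
    have "\<epsilon> / 2 - a * \<tau> * \<epsilon> = (\<epsilon> * \<delta>) * m / 2"
    proof -
      have "(\<epsilon> * \<delta>) * m = \<epsilon> * (m * \<delta>)" by simp
      then show ?thesis unfolding m\<delta> by (simp add: algebra_simps)
    qed
    from order_iff_of_diff_eq(1)[OF this \<epsilon>\<delta>] show ?thesis .
  qed
  have lower: "4 * \<tau>\<^sup>2 * \<epsilon> / \<kappa> - \<epsilon> / 2 < a * \<tau> * \<epsilon> \<longleftrightarrow> m < 2 / \<kappa>" if "\<kappa> > 0"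
  proof -
    have "a * \<tau> * \<epsilon> - (4 * \<tau>\<^sup>2 * \<epsilon> / \<kappa> - \<epsilon> / 2) = (\<epsilon> * \<delta>) * (2 / \<kappa> - m) / 2"
    proof -
      have "(\<epsilon> * \<delta>) * (2 / \<kappa> - m) = \<epsilon> * (2 * \<delta> / \<kappa> - m * \<delta>)" by (simp add: algebra_simps)
      then show ?thesis using that unfolding m\<delta> by (simp add: \<delta>_def field_simps)
    qed
    from order_iff_of_diff_eq(1)[OF this \<epsilon>\<delta>] show ?thesis by simp
  qed
  \<comment> \<open>The two ranges for \<open>\<kappa> > 0\<close> meet at \<open>m = 1/\<kappa>\<close>, the fixed point of the reflection \<open>m \<mapsto> 2/\<kappa> - m\<close>.\<close>
  have middle: "2 * \<tau>\<^sup>2 * \<epsilon> / \<kappa> \<le> a * \<tau> * \<epsilon> \<longleftrightarrow> m \<le> 1 / \<kappa>"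
      "a * \<tau> * \<epsilon> \<le> 2 * \<tau>\<^sup>2 * \<epsilon> / \<kappa> \<longleftrightarrow> 1 / \<kappa> \<le> m" if "\<kappa> > 0"
  proof -
    have "a * \<tau> * \<epsilon> - 2 * \<tau>\<^sup>2 * \<epsilon> / \<kappa> = (\<epsilon> * \<delta>) * (1 / \<kappa> - m) / 2"
    proof -
      have "(\<epsilon> * \<delta>) * (1 / \<kappa> - m) = \<epsilon> * (\<delta> / \<kappa> - m * \<delta>)" by (simp add: algebra_simps)
      then show ?thesis using that unfolding m\<delta> by (simp add: \<delta>_def field_simps)
    qed
    from order_iff_of_diff_eq(2,3)[OF this \<epsilon>\<delta>]
    show "2 * \<tau>\<^sup>2 * \<epsilon> / \<kappa> \<le> a * \<tau> * \<epsilon> \<longleftrightarrow> m \<le> 1 / \<kappa>"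
      "a * \<tau> * \<epsilon> \<le> 2 * \<tau>\<^sup>2 * \<epsilon> / \<kappa> \<longleftrightarrow> 1 / \<kappa> \<le> m"
      by simp_all
  qed
  \<comment> \<open>The two lower bounds on \<open>H\<^sup>2\<close> are the inequalities that control the balance near the two ends of the energy range.\<close>
  have low: "m * (4 * H\<^sup>2 + \<kappa>) > 1"
    if "m > 0" "H\<^sup>2 > (2 * \<tau>\<^sup>2 - a * \<tau> * \<kappa>) / (4 * a * \<tau> - 2)"
  proof -
    define \<nu> where "\<nu> = (2 * \<tau>\<^sup>2 - a * \<tau> * \<kappa>) / \<delta>"
    have "4 * a * \<tau> - 2 = - (2 * m) * \<delta>" using m\<delta> by simp
    then have "(2 * \<tau>\<^sup>2 - a * \<tau> * \<kappa>) / (4 * a * \<tau> - 2) = - \<nu> / (2 * m)"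
      using \<delta> by (simp add: \<nu>_def)
    with that(2) have "- \<nu> / (2 * m) < H\<^sup>2" by (simp only:)
    then have "- \<nu> < H\<^sup>2 * (2 * m)"
      using that(1) by (simp only: pos_divide_less_eq mult_pos_pos zero_less_numeral)
    moreover have "m * (4 * H\<^sup>2 + \<kappa>) - 1 = 2 * (\<nu> + H\<^sup>2 * (2 * m))"
    proof -
      have "\<delta> * (m * (4 * H\<^sup>2 + \<kappa>) - 1) = m * \<delta> * (4 * H\<^sup>2 + \<kappa>) - \<delta>" by (simp add: algebra_simps)
      also have "\<dots> = 2 * (2 * \<tau>\<^sup>2 - a * \<tau> * \<kappa> + 2 * (m * \<delta>) * H\<^sup>2)"
        unfolding m\<delta> by (simp add: \<delta>_def algebra_simps)
      also have "2 * \<tau>\<^sup>2 - a * \<tau> * \<kappa> = \<delta> * \<nu>" using \<delta> by (simp add: \<nu>_def)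
      also have "2 * (\<delta> * \<nu> + 2 * (m * \<delta>) * H\<^sup>2) = \<delta> * (2 * (\<nu> + H\<^sup>2 * (2 * m)))"
        by (simp add: algebra_simps)
      finally show ?thesis using \<delta> by simp
    qed
    ultimately show ?thesis by simp
  qed
  have high: "(2 / \<kappa> - m) * (4 * H\<^sup>2 + \<kappa>) > 1"
    if "\<kappa> > 0" "m < 2 / \<kappa>" "H\<^sup>2 > (2 * \<tau>\<^sup>2 - a * \<tau> * \<kappa>) / (4 * a * \<tau> + 2 - 16 * \<tau>\<^sup>2 / \<kappa>)"
  proof -
    define n where "n = 2 / \<kappa> - m"
    have n: "n > 0" using that by (simp add: n_def)
    have n\<delta>: "n * \<delta> = 2 * a * \<tau> + 1 - 8 * \<tau>\<^sup>2 / \<kappa>"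
    proof -
      have "n * \<delta> = 2 * \<delta> / \<kappa> - m * \<delta>" by (simp add: n_def algebra_simps)
      then show ?thesis using that(1) unfolding m\<delta> by (simp add: \<delta>_def field_simps)
    qed
    define \<nu> where "\<nu> = (2 * \<tau>\<^sup>2 - a * \<tau> * \<kappa>) / \<delta>"
    have "4 * a * \<tau> + 2 - 16 * \<tau>\<^sup>2 / \<kappa> = (2 * n) * \<delta>" using n\<delta> by simp
    then have "(2 * \<tau>\<^sup>2 - a * \<tau> * \<kappa>) / (4 * a * \<tau> + 2 - 16 * \<tau>\<^sup>2 / \<kappa>) = \<nu> / (2 * n)"
      using \<delta> by (simp add: \<nu>_def)
    with that(3) have "\<nu> / (2 * n) < H\<^sup>2" by (simp only:)
    then have "\<nu> < H\<^sup>2 * (2 * n)"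
      using n by (simp only: pos_divide_less_eq mult_pos_pos zero_less_numeral)
    moreover have "n * (4 * H\<^sup>2 + \<kappa>) - 1 = 2 * (H\<^sup>2 * (2 * n) - \<nu>)"
    proof -
      have "\<delta> * (n * (4 * H\<^sup>2 + \<kappa>) - 1) = 4 * (n * \<delta>) * H\<^sup>2 + ((n * \<delta>) * \<kappa> - \<delta>)"
        by (simp add: algebra_simps)
      also have "(n * \<delta>) * \<kappa> - \<delta> = - 2 * (2 * \<tau>\<^sup>2 - a * \<tau> * \<kappa>)"
        unfolding n\<delta> using that(1) by (simp add: \<delta>_def field_simps)
      also have "2 * \<tau>\<^sup>2 - a * \<tau> * \<kappa> = \<delta> * \<nu>" using \<delta> by (simp add: \<nu>_def)
      finally have "\<delta> * (n * (4 * H\<^sup>2 + \<kappa>) - 1) = \<delta> * (2 * (H\<^sup>2 * (2 * n) - \<nu>))"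
        by (simp add: algebra_simps)
      then show ?thesis using \<delta> by simp
    qed
    ultimately show ?thesis by (simp add: n_def)
  qed
  \<comment> \<open>In each of the two ranges for \<open>\<kappa> > 0\<close>, one of the two end conditions holds automatically.\<close>
  have gt_of_ge: "x * (4 * H\<^sup>2 + \<kappa>) > 1" if "\<kappa> > 0" "x \<ge> 1 / \<kappa>" for x
  proof -
    have "x > 0" "x * \<kappa> \<ge> 1"
      using that by (auto simp: pos_divide_le_eq intro: less_le_trans[of 0 "1 / \<kappa>"])
    moreover have "x * (4 * H\<^sup>2) > 0" using \<open>x > 0\<close> assms(3) by simp
    ultimately show ?thesis by (simp add: distrib_left)
  qed
  show ?thesis
    unfolding tube_exists_iff_vertical_period_zero[OF assms(3,4)]
  proof (intro conjI impI, goal_cases)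
    case 1
    then have "m * (4 * H\<^sup>2 + \<kappa>) > 1 \<and> (\<kappa> > 0 \<longrightarrow> (2 / \<kappa> - m) * (4 * H\<^sup>2 + \<kappa>) > 1)"
    proof (elim disjE conjE, goal_cases)
      case 1
      then show ?thesis using upper low by simp
    next
      case 2
      then have "m \<le> 1 / \<kappa>" "m > 0" using upper middle by auto
      moreover have "2 / \<kappa> = 1 / \<kappa> + 1 / \<kappa>" by simp
      ultimately have "2 / \<kappa> - m \<ge> 1 / \<kappa>" by linarith
      with 2 \<open>m > 0\<close> show ?thesis using low gt_of_ge by simp
    next
      case 3
      then have "1 / \<kappa> \<le> m" "m < 2 / \<kappa>" using lower middle by auto
      with 3 show ?thesis using high gt_of_ge by simp
    qed
    then show ?case
      using vertical_period_zero_exists[OF assms(3,4), of \<tau> a] assms(1)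
      by (simp add: m_def \<delta>_def)
  next
    case 2
    then have "m \<le> 0 \<or> (\<kappa> > 0 \<and> m \<ge> 2 / \<kappa>)"
      using upper lower by (auto simp: not_less)
    then show ?case
      using vertical_period_nonzero[of \<kappa> H _ \<tau> a] assms(1)
      by (auto simp: m_def \<delta>_def)
  qed
qed

end
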